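(* Let $n>k$ be two positive integers, let $A\in\mathcal{U}\subset\mathbb{R}^{kn}$, and let $\mathcal{E}$ be the collection of all $(k+1)$-subsets of $\{1,2,\ldots,n\}$. Let $\mathcal{D}\subseteq\mathcal{E}$ be a concurrency closed subcollection and let $\mathcal{S}=\{D_1,D_2,\ldots,D_r\}$ be the collection of sets of concurrencies in $\mathcal{D}$. Then: (1) (a) $\mathcal{S}\in P(n,k)$; and (b) $V_{\mathcal{S}}=\sum_{E\subseteq D_i\text{ for some }1\le i\le r,\ |E|=k+1}V_E=\sum_{E\in\mathcal{D}}V_E=V_{\mathcal{D}}$. Moreover, $\mathcal{S}$ is uniquely determined by the two properties (a), (b): if $\mathcal{T}\in P(n,k)$ and $V_{\mathcal{T}}=V_{\mathcal{D}}$, then $\mathcal{T}=\mathcal{S}$. (2) If the concurrency sets are $D_i=\{j^i_1<j^i_2<\cdots<j^i_{m_i}\}$, $1\le i\le r$, then a base collection for $\mathcal{D}$ is given by $\mathcal{D}'=\{\{j^i_1,j^i_2,\ldots,j^i_k,j^i_l\}\mid k+1\le l\le m_i,\ 1\le i\le r\}$. (3) The cardinality of any base of $\mathcal{D}$ is $\sum_{D\in\mathcal{S}}\nu(D)$.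
   Context: $\nu(S)=\max(0,|S|-k)$ for $S\subseteq\{1,\ldots,n\}$. The set $\mathcal{U}$: for an $n\times k$ matrix $X=[x_{ij}]$ and a $(k+1)$-subset $S=\{i_1<\cdots<i_{k+1}\}$ of $\{1,\ldots,n\}$, let $L_{S,X}(y_1,\ldots,y_n)$ be the determinant of the $(k+1)\times(k+1)$ matrix with $t$-th row $(x_{i_t1},\ldots,x_{i_tk},y_{i_t})$, a linear form in $y$. Let $\mathrm{Disc}(X)$ be the $\binom{n}{k+1}\times n$ matrix whose row indexed by $S$ is the coefficient vector of $L_{S,X}$. For a collection $\mathcal{S}=\{S_1,\ldots,S_l\}$ of distinct $(k+1)$-subsets, let $P_{\mathcal{S}}(X)$ be the sum of squares of all $l\times l$ minors of the submatrix of $\mathrm{Disc}(X)$ with rows $S_1,\ldots,S_l$. Then $\mathcal{U}$ is the set of real $n\times k$ matrices $A$, all of whose $k\times k$ minors are nonzero, such that $P_{\mathcal{S}}(A)\ne0$ whenever $P_{\mathcal{S}}(X)$ is not the zero polynomial in the indeterminates $x_{ij}$. For a collection $\mathcal{S}$ of subsets of $\{1,\ldots,n\}$, $V_{\mathcal{S}}\subseteq\mathbb{R}^n$ is the span of the rows of $\mathrm{Disc}(A)$ indexed by the $(k+1)$-sets contained in some member of $\mathcal{S}$; write $V_S=V_{\{S\}}$. $P(n,k)$ is the set of all (possibly empty) collections $\{S_1,\ldots,S_r\}$ of distinct subsets of $\{1,\ldots,n\}$, each of cardinality at least $k+1$, such that $\left|\bigcup_{i\in I}S_i\right|>k+\sum_{i\in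 I}(|S_i|-k)$ for all $I\subseteq\{1,\ldots,r\}$ with $|I|\ge2$. A collection $\mathcal{D}\subseteq\mathcal{E}$ is concurrency closed if every $S\in\mathcal{E}$ satisfying the following criterion with respect to $\mathcal{D}$ belongs to $\mathcal{D}$: there exists $\{S_1,\ldots,S_r\}\subseteq\mathcal{D}$ (distinct sets, $S_i\ne S$ for all $i$) such that $\left|\bigcup_{j\in J}S_j\right|\ge k+|J|$ for every nonempty $J\subseteq\{1,\ldots,r\}$ and $\left|\bigcup_{i=1}^rS_i\cup S\right|<k+r+1$. The concurrency closure $\overline{\mathcal{D}}$ of an arbitrary $\mathcal{D}\subseteq\mathcal{E}$ is obtained by repeatedly adding to the collection all $S\in\mathcal{E}$ satisfying this criterion with respect to the current collection, until it stabilizes. A collection $\widetilde{\mathcal{D}}\subseteq\mathcal{E}$ is a base collection (base) for $\mathcal{D}$ if $\overline{\widetilde{\mathcal{D}}}=\overline{\mathcal{D}}$ and $\widetilde{\mathcal{D}}$ is minimal under inclusion with this property: any $\mathcal{D}'\subseteq\widetilde{\mathcal{D}}$ with $\overline{\mathcal{D}'}=\overline{\mathcal{D}}$ equals $\widetilde{\mathcal{D}}$. For a concurrency closed $\mathcal{D}$, a set of concurrency (concurrency set) in $\mathcal{D}$ is a subset $D\subseteq\{1,\ldots,n\}$ with $|D|\ge k+1$, all of whose $(k+1)$-subsets belong to $\mathcal{D}$, and which is maximal under inclusion with this property. *)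

theory Defs
  imports
    "HOL-Library.Poly_Mapping"
    "Jordan_Normal_Form.Determinant"
    "Jordan_Normal_Form.DL_Submatrix"
    "Jordan_Normal_Form.VS_Connect"
begin

text \<open>
  Matrix and vector indices start at 0, so the ground set \<open>{1, ..., n}\<close> is rendered
  as \<open>{..<n}\<close>, with its usual order. For a finite set \<open>S\<close> of naturals and \<open>t < card S\<close>,
  \<^term>\<open>pick S t\<close> is the element of \<open>S\<close> that has exactly \<open>t\<close> smaller elements in \<open>S\<close>.
\<close>

definition ksubsets :: "nat \<Rightarrow> nat \<Rightarrow> nat set set" where
  "ksubsets n m = {S. S \<subseteq> {..<n} \<and> card S = m}"

text \<open>Truncated subtraction gives the maximum with 0.\<close>

definition nu :: "nat \<Rightarrow> nat set \<Rightarrow> nat" where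
  "nu k S = card S - k"


subsection \<open>The discriminantal matrix and generic configurations\<close>

definition lin_form :: "nat \<Rightarrow> 'a::comm_ring_1 mat \<Rightarrow> nat set \<Rightarrow> 'a vec \<Rightarrow> 'a" where
  "lin_form k X S y =
     det (mat (k + 1) (k + 1) (\<lambda>(t, j). if j < k then X $$ (pick S t, j) else y $ pick S t))"

text \<open>
  The coefficient of \<open>y\<^sub>j\<close> in the linear form is its value at the \<open>j\<close>-th unit vector.
  \<open>disc_row n k X S\<close> is the row of \<open>Disc(X)\<close> indexed by \<open>S\<close>.
\<close>

definition disc_row :: "nat \<Rightarrow> nat \<Rightarrow> 'a::comm_ring_1 mat \<Rightarrow> nat set \<Rightarrow> 'a vec" where
  "disc_row n k X S = vec n (\<lambda>j. lin_form k X S (unit_vec n j))"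

text \<open>
  A collection of row indices is given as a list without repetitions; reordering the list
  changes the minors at most by a common sign, and hence not the sum of their squares.
\<close>

definition disc_submatrix :: "nat \<Rightarrow> nat \<Rightarrow> 'a::comm_ring_1 mat \<Rightarrow> nat set list \<Rightarrow> 'a mat" where
  "disc_submatrix n k X Ss = mat_of_rows n (map (disc_row n k X) Ss)"

definition sum_sq_minors :: "nat \<Rightarrow> nat \<Rightarrow> nat set list \<Rightarrow> 'a::comm_ring_1 mat \<Rightarrow> 'a" where
  "sum_sq_minors n k Ss X =
     (\<Sum>J\<in>ksubsets n (length Ss). (det (submatrix (disc_submatrix n k X Ss) UNIV J))\<^sup>2)"

text \<open>
  Real polynomials in the indeterminates \<open>x\<^sub>i\<^sub>j\<close>: finitely supported functions from monomials
  to coefficients, a monomial being a finitely supported function from index pairs to exponents.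
\<close>

type_synonym xpoly = "((nat \<times> nat) \<Rightarrow>\<^sub>0 nat) \<Rightarrow>\<^sub>0 real"

definition indet :: "nat \<Rightarrow> nat \<Rightarrow> xpoly" where
  "indet i j = Poly_Mapping.single (Poly_Mapping.single (i, j) 1) 1"

definition indet_mat :: "nat \<Rightarrow> nat \<Rightarrow> xpoly mat" where
  "indet_mat n k = mat n k (\<lambda>(i, j). indet i j)"

definition generic_mats :: "nat \<Rightarrow> nat \<Rightarrow> real mat set" where
  "generic_mats n k =
     {A \<in> carrier_mat n k.
        (\<forall>I\<in>ksubsets n k. det (submatrix A I UNIV) \<noteq> 0) \<and>
        (\<forall>Ss. distinct Ss \<and> set Ss \<subseteq> ksubsets n (k + 1) \<and>
              sum_sq_minors n k Ss (indet_mat n k) \<noteq> 0 \<longrightarrow>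
              sum_sq_minors n k Ss A \<noteq> 0)}"


subsection \<open>The subspaces spanned by rows\<close>

definition row_span :: "nat \<Rightarrow> nat \<Rightarrow> real mat \<Rightarrow> nat set set \<Rightarrow> real vec set" where
  "row_span n k A \<S> =
     LinearCombinations.module.span class_ring (module_vec TYPE(real) n)
       {disc_row n k A E | E. E \<in> ksubsets n (k + 1) \<and> (\<exists>S\<in>\<S>. E \<subseteq> S)}"

text \<open>Sum of a finite family of subspaces of \<open>\<real>\<^sup>n\<close>; the empty sum is the zero subspace.\<close>

definition subspace_Sum :: "nat \<Rightarrow> 'i set \<Rightarrow> ('i \<Rightarrow> real vec set) \<Rightarrow> real vec set" where
  "subspace_Sum n I W = {finsum_vec TYPE(real) n w I | w. \<forall>i\<in>I. w i \<in> W i}"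


subsection \<open>Collections of subsets\<close>

definition Pnk :: "nat \<Rightarrow> nat \<Rightarrow> nat set set set" where
  "Pnk n k =
     {\<S>. \<S> \<subseteq> Pow {..<n} \<and> (\<forall>S\<in>\<S>. k + 1 \<le> card S) \<and>
          (\<forall>I\<subseteq>\<S>. 2 \<le> card I \<longrightarrow> card (\<Union>I) > k + (\<Sum>S\<in>I. card S - k))}"

definition conc_criterion :: "nat \<Rightarrow> nat set set \<Rightarrow> nat set \<Rightarrow> bool" where
  "conc_criterion k \<D> S \<longleftrightarrow>
     (\<exists>\<F>\<subseteq>\<D>. S \<notin> \<F> \<and>
        (\<forall>J\<subseteq>\<F>. J \<noteq> {} \<longrightarrow> card (\<Union>J) \<ge> k + card J) \<and>
        card (\<Union>\<F> \<union> S) < k + card \<F> + 1)"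

definition conc_closed :: "nat \<Rightarrow> nat \<Rightarrow> nat set set \<Rightarrow> bool" where
  "conc_closed n k \<D> \<longleftrightarrow>
     \<D> \<subseteq> ksubsets n (k + 1) \<and>
     (\<forall>S\<in>ksubsets n (k + 1). conc_criterion k \<D> S \<longrightarrow> S \<in> \<D>)"

definition conc_step :: "nat \<Rightarrow> nat \<Rightarrow> nat set set \<Rightarrow> nat set set" where
  "conc_step n k \<D> = \<D> \<union> {S \<in> ksubsets n (k + 1). conc_criterion k \<D> S}"

text \<open>
  The iterates increase inside a finite set, so their union is the collection at which
  they stabilize.
\<close>

definition conc_closure :: "nat \<Rightarrow> nat \<Rightarrow> nat set set \<Rightarrow> nat set set" where
  "conc_closure n k \<D> = (\<Union>m. (conc_step n k ^^ m) \<D>)"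

definition is_base :: "nat \<Rightarrow> nat \<Rightarrow> nat set set \<Rightarrow> nat set set \<Rightarrow> bool" where
  "is_base n k \<D> \<B> \<longleftrightarrow>
     \<B> \<subseteq> ksubsets n (k + 1) \<and>
     conc_closure n k \<B> = conc_closure n k \<D> \<and>
     (\<forall>\<B>'\<subseteq>\<B>. conc_closure n k \<B>' = conc_closure n k \<D> \<longrightarrow> \<B>' = \<B>)"

definition all_subsets_in :: "nat \<Rightarrow> nat \<Rightarrow> nat set set \<Rightarrow> nat set \<Rightarrow> bool" where
  "all_subsets_in n k \<D> D \<longleftrightarrow>
     D \<subseteq> {..<n} \<and> k + 1 \<le> card D \<and> (\<forall>E\<subseteq>D. card E = k + 1 \<longrightarrow> E \<in> \<D>)"

definition conc_sets :: "nat \<Rightarrow> nat \<Rightarrow> nat set set \<Rightarrow> nat set set" where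
  "conc_sets n k \<D> =
     {D. all_subsets_in n k \<D> D \<and> (\<forall>D'. all_subsets_in n k \<D> D' \<and> D \<subseteq> D' \<longrightarrow> D' = D)}"

end

theory Submission
  imports Defs "HOL-Library.Function_Algebras"
begin

text \<open>
  When no \<open>k \<times> k\<close> minor of \<open>A\<close> vanishes, the row of \<open>Disc(A)\<close> indexed by \<open>E\<close> is, up to
  a factor, the only vector that is supported on \<open>E\<close> and orthogonal to the columns of \<open>A\<close>.
  Everything rests on the resulting description of linear independence: for \<open>A\<close> in \<open>\<U>\<close>, the
  rows of a collection \<open>\<F>\<close> are independent if and only if every nonempty \<open>J \<subseteq> \<F>\<close> satisfies
  \<open>\<bar>\<Union>J\<bar> \<ge> k + \<bar>J\<bar>\<close> (\<open>generic_independent_iff_hall\<close>).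

  The condition is necessary because the vectors that are supported on a set \<open>M\<close> and orthogonal
  to the columns form a space of dimension \<open>\<bar>M\<bar> - k\<close>. It is sufficient because membership in \<open>\<U>\<close>
  makes the rows independent as soon as the rows of a single real configuration \<open>X\<close> are. Such an \<open>X\<close>
  is constructed backwards, after enlarging the collection to \<open>n - k\<close> sets: vectors \<open>u\<^sub>E\<close>
  supported on \<open>E\<close> are chosen one after the other, each outside finitely many proper subspaces,
  so that together they remain independent modulo every coordinate subspace of dimension \<open>k\<close>
  (\<open>generic_choice\<close>); the columns of \<open>X\<close> are then the functionals that cut out their span, and
  the rows of \<open>Disc(X)\<close> can only be multiples of the \<open>u\<^sub>E\<close>.

  With this description, the concurrency criterion says that a row depends linearly on others.
  So concurrency closed collections are the flats of a matroid, and base collections are its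
  bases. The rest is combinatorics of the numbers \<open>\<bar>\<Union>J\<bar> - k\<close>. Call \<open>J\<close> tight if
  \<open>\<bar>\<Union>J\<bar> = k + \<bar>J\<bar>\<close>. By submodularity, two tight subcollections of a basis \<open>\<B>\<close> whose unions
  share at least \<open>k\<close> points have a tight union. Hence the maximal tight subcollections
  partition \<open>\<B>\<close>, and their unions turn out to be exactly the concurrency sets of the flat
  (\<open>conc_sets_eq_Union_max_tight\<close>). A union of several maximal tight subcollections is not tight,
  which is the strict inequality in the definition of \<open>P(n,k)\<close>, and counting \<open>\<B>\<close> by blocks gives
  the cardinality in (3). Conversely, for \<open>\<T>\<close> in \<open>P(n,k)\<close> the sets \<open>K \<union> {x}\<close>, with one \<open>k\<close>-set
  \<open>K \<subseteq> S\<close> for each \<open>S \<in> \<T>\<close> and \<open>x \<in> S - K\<close>, index a basis of \<open>V\<^sub>\<T>\<close> whose maximal tight subcollections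
  are the stars of the members of \<open>\<T>\<close>. This recovers \<open>\<T>\<close> from \<open>V\<^sub>\<T>\<close> and gives the base in (2).
\<close>

section \<open>Collections with the Hall condition\<close>

text \<open>
  For \<open>k > 0\<close> the empty subcollection has to be exempt, as its union is empty.
\<close>

definition hall :: "nat \<Rightarrow> nat set set \<Rightarrow> bool" where
  "hall k \<F> \<longleftrightarrow> (\<forall>J\<subseteq>\<F>. J \<noteq> {} \<longrightarrow> k + card J \<le> card (\<Union>J))"

definition hall_basis :: "nat \<Rightarrow> nat set set \<Rightarrow> nat set set \<Rightarrow> bool" where
  "hall_basis k \<D> \<B> \<longleftrightarrow> \<B> \<subseteq> \<D> \<and> hall k \<B> \<and> (\<forall>E\<in>\<D> - \<B>. \<not> hall k (insert E \<B>))"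

text \<open>
  If the rows of a tight collection are independent, they span all vectors that are supported on
  \<open>\<Union>T\<close> and orthogonal to the columns of the matrix, by a count of dimensions.
\<close>

definition tight :: "nat \<Rightarrow> nat set set \<Rightarrow> bool" where
  "tight k T \<longleftrightarrow> T \<noteq> {} \<and> card (\<Union>T) = k + card T"

definition max_tight :: "nat \<Rightarrow> nat set set \<Rightarrow> nat set set set" where
  "max_tight k \<B> = {T. T \<subseteq> \<B> \<and> tight k T \<and> (\<forall>T'. T' \<subseteq> \<B> \<and> tight k T' \<and> T \<subseteq> T' \<longrightarrow> T' = T)}"

text \<open>
  The sets of the star with kernel \<open>K\<close>, for \<open>\<bar>K\<bar> = k\<close>, index rows that form a
  triangular system: the row of \<open>K \<union> {x}\<close> is the only one whose support contains \<open>x\<close>.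
\<close>

definition star :: "nat set \<Rightarrow> nat set \<Rightarrow> nat set set" where
  "star K D = (\<lambda>x. insert x K) ` (D - K)"

lemma ksubsets_finite: "finite (ksubsets n m)"
  by (rule finite_subset[of _ "Pow {..<n}"]) (auto simp: ksubsets_def)

lemma ksubsetsD:
  assumes "E \<in> ksubsets n m"
  shows "E \<subseteq> {..<n}" "card E = m" "finite E"
  using assms finite_subset[of E "{..<n}"] by (auto simp: ksubsets_def)

lemma finite_Union_ksubsets: "J \<subseteq> ksubsets n m \<Longrightarrow> finite (\<Union>J)"
  by (rule finite_subset[of _ "{..<n}"]) (auto simp: ksubsets_def)

lemma Union_ksubsets_le: "J \<subseteq> ksubsets n m \<Longrightarrow> \<Union>J \<subseteq> {..<n}"
  by (auto simp: ksubsets_def)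

lemma hall_mono: "hall k \<F> \<Longrightarrow> \<G> \<subseteq> \<F> \<Longrightarrow> hall k \<G>"
  unfolding hall_def by blast

lemma hallD: "hall k \<F> \<Longrightarrow> J \<subseteq> \<F> \<Longrightarrow> J \<noteq> {} \<Longrightarrow> k + card J \<le> card (\<Union>J)"
  unfolding hall_def by blast

text \<open>
  Uncrossing: the cardinality of the union of a collection is submodular, and the number of sets is modular. If
  \<open>T\<close> and \<open>T'\<close> have a common member, the bound on the intersection comes from the Hall
  condition for \<open>T \<inter> T'\<close>, otherwise from the assumption.
\<close>

lemma tight_Un:
  assumes B: "\<B> \<subseteq> ksubsets n (k + 1)" "hall k \<B>"
    and T: "T \<subseteq> \<B>" "T' \<subseteq> \<B>" "tight k T" "tight k T'"
    and meet: "k \<le> card (\<Union>T \<inter> \<Union>T')"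
  shows "tight k (T \<union> T')"
proof -
  have fin: "finite (\<Union>T)" "finite (\<Union>T')" "finite T" "finite T'"
    using T B finite_Union_ksubsets finite_subset[OF _ ksubsets_finite] by (metis order_trans)+
  have 1: "k + card (T \<inter> T') \<le> card (\<Union>T \<inter> \<Union>T')"
  proof (cases "T \<inter> T' = {}")
    case True
    then show ?thesis using meet by simp
  next
    case False
    then have "k + card (T \<inter> T') \<le> card (\<Union>(T \<inter> T'))"
      using B T by (intro hallD[of k \<B>]) auto
    also have "\<dots> \<le> card (\<Union>T \<inter> \<Union>T')"
      using fin by (intro card_mono) auto
    finally show ?thesis .
  qed
  have 2: "card (\<Union>T) + card (\<Union>T') = card (\<Union>(T \<union> T')) + card (\<Union>T \<inter> \<Union>T')"
    using card_Un_Int[of "\<Union>T" "\<Union>T'"] fin by simp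
  have 3: "card T + card T' = card (T \<union> T') + card (T \<inter> T')"
    using card_Un_Int fin by blast
  have 4: "k + card (T \<union> T') \<le> card (\<Union>(T \<union> T'))"
    using B T by (intro hallD[of k \<B>]) (auto simp: tight_def)
  show ?thesis using 1 2 3 4 T(3,4) unfolding tight_def by auto
qed

lemma tight_le_max_tight:
  assumes "finite \<B>" "T \<subseteq> \<B>" "tight k T"
  obtains M where "M \<in> max_tight k \<B>" "T \<subseteq> M"
proof -
  let ?P = "{T'. T' \<subseteq> \<B> \<and> tight k T'}"
  have "finite ?P" using assms by (intro finite_subset[of ?P "Pow \<B>"]) auto
  then obtain M where "M \<in> ?P" "T \<subseteq> M" "\<forall>T'\<in>?P. M \<subseteq> T' \<longrightarrow> M = T'"
    using finite_has_maximal2[of ?P T] assms by blast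
  then show ?thesis by (intro that[of M]) (auto simp: max_tight_def)
qed

lemma max_tight_eqI:
  assumes B: "\<B> \<subseteq> ksubsets n (k + 1)" "hall k \<B>"
    and M: "M \<in> max_tight k \<B>" "M' \<in> max_tight k \<B>" and meet: "k \<le> card (\<Union>M \<inter> \<Union>M')"
  shows "M = M'"
proof -
  have "tight k (M \<union> M')" "M \<union> M' \<subseteq> \<B>"
    using tight_Un[OF B _ _ _ _ meet] M by (auto simp: max_tight_def)
  then have "M \<union> M' = M" "M \<union> M' = M'" using M by (auto simp: max_tight_def)
  then show ?thesis by simp
qed

lemma max_tight_disjoint:
  assumes B: "\<B> \<subseteq> ksubsets n (k + 1)" "hall k \<B>"
    and M: "M \<in> max_tight k \<B>" "M' \<in> max_tight k \<B>" and ne: "M \<noteq> M'"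
  shows "M \<inter> M' = {}"
proof (rule ccontr)
  assume "M \<inter> M' \<noteq> {}"
  then obtain E where E: "E \<in> M" "E \<in> M'" by blast
  have sub: "M \<subseteq> ksubsets n (k+1)" "M' \<subseteq> ksubsets n (k+1)"
    using B M by (auto simp: max_tight_def)
  have "card E \<le> card (\<Union>M \<inter> \<Union>M')"
    using E finite_Union_ksubsets[OF sub(1)] by (intro card_mono) auto
  moreover have "card E = k + 1" using sub E ksubsetsD by blast
  ultimately show False using max_tight_eqI[OF B M] ne by simp
qed

lemma tight_singleton: "E \<in> ksubsets n (k + 1) \<Longrightarrow> tight k {E}"
  by (auto simp: tight_def ksubsets_def)

lemma Union_max_tight:
  assumes B: "\<B> \<subseteq> ksubsets n (k + 1)"
  shows "\<Union>(max_tight k \<B>) = \<B>"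
proof
  show "\<Union>(max_tight k \<B>) \<subseteq> \<B>" by (auto simp: max_tight_def)
  have fin: "finite \<B>" using B ksubsets_finite finite_subset by blast
  show "\<B> \<subseteq> \<Union>(max_tight k \<B>)"
  proof
    fix E assume "E \<in> \<B>"
    then show "E \<in> \<Union>(max_tight k \<B>)"
      using tight_le_max_tight[OF fin, of "{E}" k] tight_singleton[of E n k] B by blast
  qed
qed

text \<open>
  A violated instance of the Hall condition must involve the new set, so removing that set from it leaves a witness of
  the shape that the concurrency criterion asks for.
\<close>

lemma violated_insert:
  assumes "finite \<B>" "hall k \<B>" "\<not> hall k (insert E \<B>)" "card E = k + 1"
  obtains T where "T \<subseteq> \<B>" "T \<noteq> {}" "E \<notin> T" "card (\<Union>T \<union> E) < k + card T + 1"
proof -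
  obtain J where J: "J \<subseteq> insert E \<B>" "J \<noteq> {}" "\<not> k + card J \<le> card (\<Union>J)"
    using assms unfolding hall_def by blast
  have EJ: "E \<in> J" using J assms(2) unfolding hall_def by blast
  have U: "\<Union>J = \<Union>(J - {E}) \<union> E" using EJ by blast
  show ?thesis
  proof (rule that[of "J - {E}"])
    show "J - {E} \<subseteq> \<B>" using J by blast
    show "J - {E} \<noteq> {}"
    proof
      assume "J - {E} = {}"
      then have "J = {E}" using EJ by blast
      then show False using J assms by simp
    qed
    have "finite J" using J assms finite_subset by blast
    then have "card J = card (J - {E}) + 1"
      using EJ by (metis Suc_eq_plus1 card_Suc_Diff1)
    then show "card (\<Union>(J - {E}) \<union> E) < k + card (J - {E}) + 1"
      using J U by simp
  qed auto
qed

lemma hall_basis_finite: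
  assumes "\<D> \<subseteq> ksubsets n (k + 1)" "hall_basis k \<D> \<B>"
  shows "finite \<B>" "\<B> \<subseteq> ksubsets n (k + 1)" "hall k \<B>"
proof -
  show "\<B> \<subseteq> ksubsets n (k + 1)" using assms by (auto simp: hall_basis_def)
  then show "finite \<B>" using finite_subset[OF _ ksubsets_finite] by blast
  show "hall k \<B>" using assms by (simp add: hall_basis_def)
qed

lemma hall_basis_exists:
  assumes \<D>: "\<D> \<subseteq> ksubsets n (k + 1)" and \<F>: "\<F> \<subseteq> \<D>" "hall k \<F>"
  obtains \<B> where "hall_basis k \<D> \<B>" "\<F> \<subseteq> \<B>"
proof -
  let ?P = "{\<B>. \<B> \<subseteq> \<D> \<and> hall k \<B>}"
  have "finite \<D>" using \<D> ksubsets_finite finite_subset by blast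
  then have "finite ?P" by (intro finite_subset[of ?P "Pow \<D>"]) auto
  then obtain \<B> where B: "\<B> \<in> ?P" "\<F> \<subseteq> \<B>" "\<forall>\<B>'\<in>?P. \<B> \<subseteq> \<B>' \<longrightarrow> \<B> = \<B>'"
    using finite_has_maximal2[of ?P \<F>] \<F> by blast
  have "hall_basis k \<D> \<B>"
    unfolding hall_basis_def
  proof (intro conjI ballI notI)
    fix E assume "E \<in> \<D> - \<B>" "hall k (insert E \<B>)"
    then show False using B by blast
  qed (use B in auto)
  then show ?thesis using that B by blast
qed

text \<open>
  If \<open>E\<close> cannot be added to the basis, the \<open>T\<close> from \<open>violated_insert\<close> satisfies
  \<open>k + \<bar>T\<bar> \<le> \<bar>\<Union>T\<bar> \<le> \<bar>\<Union>T \<union> E\<bar> \<le> k +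
  \<bar>T\<bar>\<close>, so equality holds throughout.
\<close>

lemma element_in_tight:
  assumes \<D>: "\<D> \<subseteq> ksubsets n (k + 1)" "hall_basis k \<D> \<B>" and E: "E \<in> \<D>"
  obtains T where "T \<subseteq> \<B>" "tight k T" "E \<subseteq> \<Union>T"
proof (cases "E \<in> \<B>")
  case True
  then show ?thesis using that[of "{E}"] tight_singleton[of E n k] \<D> E by auto
next
  case False
  note B = hall_basis_finite[OF \<D>]
  have "card E = k + 1" using \<D> E ksubsetsD by blast
  moreover have "\<not> hall k (insert E \<B>)"
    using False E \<D> unfolding hall_basis_def by blast
  ultimately obtain T where T: "T \<subseteq> \<B>" "T \<noteq> {}" "card (\<Union>T \<union> E) < k + card T + 1"
    using violated_insert[OF B(1) B(3)] by metis
  have "T \<subseteq> ksubsets n (k + 1)" "E \<in> ksubsets n (k + 1)" using T B \<D>(1) E by auto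
  then have fin: "finite (\<Union>T \<union> E)"
    using finite_Union_ksubsets[of T n "k + 1"] ksubsetsD(3)[of E n "k + 1"] by simp
  have 1: "k + card T \<le> card (\<Union>T)" using hallD[OF B(3)] T by blast
  have "card (\<Union>T) \<le> card (\<Union>T \<union> E)" using fin by (intro card_mono) auto
  then have eq: "card (\<Union>T) = card (\<Union>T \<union> E)" "card (\<Union>T) = k + card T" using 1 T by auto
  have "\<Union>T = \<Union>T \<union> E" by (rule card_subset_eq[OF fin Un_upper1 eq(1)])
  then have "E \<subseteq> \<Union>T" by (metis Un_upper2)
  then show ?thesis using that[of T] T eq by (auto simp: tight_def)
qed

text \<open>
  The maximal tight subcollections that cover two \<open>(k + 1)\<close>-subsets of \<open>D\<close> with
  \<open>k\<close> common points must coincide. It is enough to compare one fixed subset with those that differ from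
  it in a single point.
\<close>

lemma subsets_in_tight:
  assumes \<D>: "\<D> \<subseteq> ksubsets n (k + 1)" "hall_basis k \<D> \<B>" and D: "all_subsets_in n k \<D> D"
  obtains M where "M \<in> max_tight k \<B>" "D \<subseteq> \<Union>M"
proof -
  note B = hall_basis_finite[OF \<D>]
  have D': "D \<subseteq> {..<n}" "k + 1 \<le> card D" "\<And>E. E \<subseteq> D \<Longrightarrow> card E = k + 1 \<Longrightarrow> E \<in> \<D>"
    using D unfolding all_subsets_in_def by auto
  have *: "\<exists>M\<in>max_tight k \<B>. E \<subseteq> \<Union>M" if E: "E \<subseteq> D" "card E = k + 1" for E
  proof -
    obtain T where T: "T \<subseteq> \<B>" "tight k T" "E \<subseteq> \<Union>T"
      using element_in_tight[OF \<D> D'(3)[OF E]] by metis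
    obtain M where M: "M \<in> max_tight k \<B>" "T \<subseteq> M"
      using tight_le_max_tight[OF B(1) T(1,2)] by metis
    have "E \<subseteq> \<Union>M" using T(3) Union_mono[OF M(2)] by (rule order_trans)
    then show ?thesis using M(1) by (rule bexI)
  qed
  obtain E0 where E0: "E0 \<subseteq> D" "card E0 = k + 1" using D'(2) obtain_subset_with_card_n by metis
  obtain K where K: "K \<subseteq> E0" "card K = k"
    using E0 obtain_subset_with_card_n[of k E0] by (metis le_add1)
  have finD: "finite D" using D'(1) finite_subset by blast
  obtain M where M: "M \<in> max_tight k \<B>" "E0 \<subseteq> \<Union>M" using *[OF E0] by blast
  have "x \<in> \<Union>M" if x: "x \<in> D" for x
  proof (cases "x \<in> K")
    case True
    then show ?thesis using K M by blast
  next
    case False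
    have "finite K" using finite_subset[of K D] finD K E0 by simp
    then have "card (insert x K) = k + 1" "insert x K \<subseteq> D"
      using False K x E0 by auto
    then obtain M' where M': "M' \<in> max_tight k \<B>" "insert x K \<subseteq> \<Union>M'" using * by blast
    have "M \<subseteq> ksubsets n (k + 1)" using M(1) B(2) by (auto simp: max_tight_def)
    then have "finite (\<Union>M)" by (rule finite_Union_ksubsets)
    then have "card K \<le> card (\<Union>M \<inter> \<Union>M')"
      using K M M' by (intro card_mono) auto
    then have "M = M'" using max_tight_eqI[OF B(2,3) M(1) M'(1)] K by simp
    then show ?thesis using M' by blast
  qed
  then show ?thesis using that M by blast
qed

text \<open>
  Adding to a tight \<open>T\<close> a set inside \<open>\<Union>T\<close> does not enlarge the union, so
  \<open>T\<close> itself witnesses the concurrency criterion.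
\<close>

lemma closed_Union_tight:
  assumes D: "conc_closed n k \<D>" and \<B>: "\<B> \<subseteq> \<D>" "hall k \<B>" and T: "T \<subseteq> \<B>" "tight k T"
  shows "all_subsets_in n k \<D> (\<Union>T)"
  unfolding all_subsets_in_def
proof (intro conjI allI impI)
  have D': "\<D> \<subseteq> ksubsets n (k + 1)" using D by (simp add: conc_closed_def)
  have T': "T \<subseteq> ksubsets n (k + 1)" using D' \<B> T by blast
  show sub: "\<Union>T \<subseteq> {..<n}" using Union_ksubsets_le[OF T'] .
  have "finite T" using T' ksubsets_finite finite_subset by blast
  then have "0 < card T" using T by (auto simp: tight_def card_gt_0_iff)
  then show "k + 1 \<le> card (\<Union>T)" using T by (simp add: tight_def)
  fix E assume E: "E \<subseteq> \<Union>T" "card E = k + 1"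
  show "E \<in> \<D>"
  proof (cases "E \<in> T")
    case True
    then show ?thesis using T \<B> by blast
  next
    case False
    have "\<Union>T \<union> E = \<Union>T" using E by blast
    moreover have "\<forall>J\<subseteq>T. J \<noteq> {} \<longrightarrow> k + card J \<le> card (\<Union>J)"
      using \<B> T unfolding hall_def by blast
    ultimately have "conc_criterion k \<D> E"
      using False T \<B> unfolding conc_criterion_def by (intro exI[of _ T]) (auto simp: tight_def)
    moreover have "E \<in> ksubsets n (k + 1)" using E sub by (auto simp: ksubsets_def)
    ultimately show ?thesis using D unfolding conc_closed_def by blast
  qed
qed

text \<open>
  Every set all of whose \<open>(k + 1)\<close>-subsets lie in \<open>\<D>\<close> is contained in the union of a
  maximal tight subcollection, and as \<open>\<D>\<close> is closed, these unions have the property themselves.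
  Different ones share fewer than \<open>k\<close> points, so that none contains another.
\<close>

lemma conc_sets_eq_Union_max_tight:
  assumes D: "conc_closed n k \<D>" and B: "hall_basis k \<D> \<B>"
  shows "conc_sets n k \<D> = Union ` max_tight k \<B>"
    and "inj_on Union (max_tight k \<B>)"
proof -
  have D': "\<D> \<subseteq> ksubsets n (k + 1)" using D by (simp add: conc_closed_def)
  note B' = hall_basis_finite[OF D' B]
  have all: "all_subsets_in n k \<D> (\<Union>M)" if "M \<in> max_tight k \<B>" for M
    using closed_Union_tight[OF D _ B'(3)] that B unfolding max_tight_def hall_basis_def by blast
  have meet: "M = M'" if M: "M \<in> max_tight k \<B>" "M' \<in> max_tight k \<B>" "\<Union>M \<subseteq> \<Union>M'" for M M'
  proof -
    have "\<Union>M \<inter> \<Union>M' = \<Union>M" using M by blast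
    then have "k \<le> card (\<Union>M \<inter> \<Union>M')" using all[OF M(1)] by (simp add: all_subsets_in_def)
    then show ?thesis using max_tight_eqI[OF B'(2,3) M(1,2)] by blast
  qed
  show "inj_on Union (max_tight k \<B>)" using meet by (intro inj_onI) auto
  show "conc_sets n k \<D> = Union ` max_tight k \<B>"
  proof (intro subset_antisym subsetI)
    fix S assume S: "S \<in> conc_sets n k \<D>"
    then have "all_subsets_in n k \<D> S" by (simp add: conc_sets_def)
    then obtain M where M: "M \<in> max_tight k \<B>" "S \<subseteq> \<Union>M"
      using subsets_in_tight[OF D' B] by metis
    then have "\<Union>M = S" using S all[OF M(1)] by (simp add: conc_sets_def)
    then show "S \<in> Union ` max_tight k \<B>" using M by blast
  next
    fix S assume "S \<in> Union ` max_tight k \<B>"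
    then obtain M where M: "M \<in> max_tight k \<B>" "S = \<Union>M" by blast
    show "S \<in> conc_sets n k \<D>"
      unfolding conc_sets_def
    proof (intro CollectI conjI allI impI)
      show "all_subsets_in n k \<D> S" using all M by simp
      fix S' assume S': "all_subsets_in n k \<D> S' \<and> S \<subseteq> S'"
      then obtain M' where M': "M' \<in> max_tight k \<B>" "S' \<subseteq> \<Union>M'"
        using subsets_in_tight[OF D' B] by metis
      then have "M = M'" using meet M S' by blast
      then show "S' = S" using M M' S' by blast
    qed
  qed
qed

lemma card_Union_max_tight:
  assumes B: "\<B> \<subseteq> ksubsets n (k + 1)" "hall k \<B>" and M: "\<M> \<subseteq> max_tight k \<B>"
  shows "card (\<Union>\<M>) = (\<Sum>M\<in>\<M>. card (\<Union>M) - k)"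
proof -
  have fin: "finite \<B>" using B ksubsets_finite finite_subset by blast
  have "card (\<Union>\<M>) = (\<Sum>M\<in>\<M>. card M)"
  proof (rule card_Union_disjoint)
    show "pairwise disjnt \<M>"
      using max_tight_disjoint[OF B] M unfolding pairwise_def disjnt_def by blast
    show "\<And>A. A \<in> \<M> \<Longrightarrow> finite A"
      using M fin finite_subset unfolding max_tight_def by blast
  qed
  also have "\<dots> = (\<Sum>M\<in>\<M>. card (\<Union>M) - k)"
    using M by (intro sum.cong) (auto simp: max_tight_def tight_def)
  finally show ?thesis .
qed

text \<open>
  For several maximal tight subcollections, the Hall condition applied to all their members gives the inequality of
  \<open>P(n,k)\<close> in weak form. Equality would make this larger subcollection tight.
\<close>

lemma conc_sets_in_Pnk:
  assumes D: "conc_closed n k \<D>"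
  shows "conc_sets n k \<D> \<in> Pnk n k"
proof -
  have D': "\<D> \<subseteq> ksubsets n (k + 1)" using D by (simp add: conc_closed_def)
  have "hall k {}" by (simp add: hall_def)
  then obtain \<B> where B: "hall_basis k \<D> \<B>" using hall_basis_exists[OF D', of "{}"] by blast
  note B' = hall_basis_finite[OF D' B]
  note eq = conc_sets_eq_Union_max_tight[OF D B]
  show ?thesis
    unfolding Pnk_def
  proof (intro CollectI conjI ballI allI impI)
    show "conc_sets n k \<D> \<subseteq> Pow {..<n}" by (auto simp: conc_sets_def all_subsets_in_def)
    show "k + 1 \<le> card S" if "S \<in> conc_sets n k \<D>" for S
      using that by (auto simp: conc_sets_def all_subsets_in_def)
    fix I assume I: "I \<subseteq> conc_sets n k \<D>" "2 \<le> card I"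
    then obtain \<M> where M: "\<M> \<subseteq> max_tight k \<B>" "I = Union ` \<M>"
      using eq(1) by (auto simp: subset_image_iff)
    have inj: "inj_on Union \<M>" using eq(2) M inj_on_subset by blast
    have "(\<Sum>S\<in>I. card S - k) = (\<Sum>M\<in>\<M>. card (\<Union>M) - k)"
      using inj unfolding M(2) by (simp add: sum.reindex)
    also have "\<dots> = card (\<Union>\<M>)" using card_Union_max_tight[OF B'(2,3) M(1)] by simp
    finally have sum: "(\<Sum>S\<in>I. card S - k) = card (\<Union>\<M>)" .
    have cardM: "2 \<le> card \<M>" using I M inj by (simp add: card_image)
    obtain M1 M2 where M12: "M1 \<in> \<M>" "M2 \<in> \<M>" "M1 \<noteq> M2"
    proof -
      obtain \<M>' where "\<M>' \<subseteq> \<M>" "card \<M>' = 2"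
        using obtain_subset_with_card_n[OF cardM] by metis
      then show ?thesis using that by (auto simp: card_2_iff)
    qed
    have ne: "\<Union>\<M> \<noteq> {}" "\<Union>\<M> \<subseteq> \<B>"
      using M12 M unfolding max_tight_def tight_def by auto
    have U: "\<Union>I = \<Union>(\<Union>\<M>)" using M by auto
    have le: "k + card (\<Union>\<M>) \<le> card (\<Union>I)" using hallD[OF B'(3) ne(2,1)] U by simp
    have "k + card (\<Union>\<M>) \<noteq> card (\<Union>I)"
    proof
      assume "k + card (\<Union>\<M>) = card (\<Union>I)"
      then have "tight k (\<Union>\<M>)" using ne U by (simp add: tight_def)
      then have "\<Union>\<M> = M1" "\<Union>\<M> = M2" using M12 M ne unfolding max_tight_def by blast+
      then show False using M12 by simp
    qed
    then show "k + (\<Sum>S\<in>I. card S - k) < card (\<Union>I)" using le sum by simp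
  qed
qed

lemma card_hall_basis:
  assumes D: "conc_closed n k \<D>" and B: "hall_basis k \<D> \<B>"
  shows "card \<B> = (\<Sum>D\<in>conc_sets n k \<D>. nu k D)"
proof -
  have D': "\<D> \<subseteq> ksubsets n (k + 1)" using D by (simp add: conc_closed_def)
  note B' = hall_basis_finite[OF D' B]
  note eq = conc_sets_eq_Union_max_tight[OF D B]
  have "card \<B> = card (\<Union>(max_tight k \<B>))" using Union_max_tight[OF B'(2)] by simp
  also have "\<dots> = (\<Sum>M\<in>max_tight k \<B>. card (\<Union>M) - k)"
    using card_Union_max_tight[OF B'(2,3)] by simp
  finally show ?thesis using eq(2) unfolding eq(1) by (simp add: sum.reindex nu_def)
qed

lemma card_star:
  assumes "finite D" "K \<subseteq> D"
  shows "card (star K D) = card D - card K"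
proof -
  have "inj_on (\<lambda>x. insert x K) (D - K)" by (intro inj_onI) blast
  then show ?thesis using assms by (simp add: star_def card_image card_Diff_subset finite_subset)
qed

lemma star_ksubsets: "D \<subseteq> {..<n} \<Longrightarrow> K \<subseteq> D \<Longrightarrow> card K = k \<Longrightarrow> star K D \<subseteq> ksubsets n (k + 1)"
  unfolding star_def ksubsets_def using finite_subset[of K "{..<n}"] by auto

lemma star_Union_card:
  assumes "finite D" "K \<subseteq> D" "J \<subseteq> star K D" "J \<noteq> {}"
  shows "card (\<Union>J) = card K + card J"
proof -
  obtain X where X: "X \<subseteq> D - K" "J = (\<lambda>x. insert x K) ` X"
    using assms unfolding star_def by (auto simp: subset_image_iff)
  have "inj_on (\<lambda>x. insert x K) X" using X by (intro inj_onI) blast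
  then have c: "card J = card X" using X by (simp add: card_image)
  have "\<Union>J = K \<union> X" using X assms by auto
  moreover have "card (K \<union> X) = card K + card X"
    using assms X finite_subset by (intro card_Un_disjoint) (auto intro: finite_subset)
  ultimately show ?thesis using c by simp
qed

lemma star_Union:
  assumes "K \<subset> D"
  shows "\<Union>(star K D) = D"
  using assms unfolding star_def by auto

lemma Pnk_finite: "\<T> \<in> Pnk n k \<Longrightarrow> finite \<T>"
  by (rule finite_subset[of _ "Pow {..<n}"]) (auto simp: Pnk_def)

lemma PnkD:
  assumes "\<T> \<in> Pnk n k" "S \<in> \<T>"
  shows "S \<subseteq> {..<n}" "k + 1 \<le> card S" "finite S"
  using assms finite_subset[of S "{..<n}"] by (auto simp: Pnk_def)

text \<open>
  For \<open>S \<subset> S'\<close>, the condition on the pair \<open>{S, S'}\<close> would give \<open>\<bar>S\<bar>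
  < k\<close>, whereas members of the collection have more than \<open>k\<close> elements.
\<close>

lemma Pnk_antichain:
  assumes T: "\<T> \<in> Pnk n k" "S \<in> \<T>" "S' \<in> \<T>" "S \<subseteq> S'"
  shows "S = S'"
proof (rule ccontr)
  assume ne: "S \<noteq> S'"
  have "{S, S'} \<subseteq> \<T>" "2 \<le> card {S, S'}" using T ne by auto
  then have "card (\<Union>{S, S'}) > k + (\<Sum>S\<in>{S, S'}. card S - k)"
    using T(1) unfolding Pnk_def by blast
  moreover have "\<Union>{S, S'} = S'" using T by blast
  ultimately show False using ne PnkD(2)[OF T(1,2)] PnkD(2)[OF T(1,3)] by simp
qed

text \<open>
  The choice of the kernels is left open: the base collection in the theorem takes the \<open>k\<close> smallest
  elements, whereas for uniqueness any choice will do.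
\<close>

locale kernels =
  fixes n k :: nat and \<T> :: "nat set set" and K :: "nat set \<Rightarrow> nat set"
  assumes T: "\<T> \<in> Pnk n k"
    and K: "\<And>S. S \<in> \<T> \<Longrightarrow> K S \<subseteq> S" "\<And>S. S \<in> \<T> \<Longrightarrow> card (K S) = k"
begin

definition "stars = (\<Union>S\<in>\<T>. star (K S) S)"

lemma stars_ksubsets: "stars \<subseteq> ksubsets n (k + 1)"
proof -
  have "star (K S) S \<subseteq> ksubsets n (k + 1)" if "S \<in> \<T>" for S
    by (rule star_ksubsets[OF PnkD(1)[OF T that] K[OF that]])
  then show ?thesis unfolding stars_def by blast
qed

text \<open>
  Restoring the sets that \<open>J\<close> omits from the stars it meets adds at most one point for each omitted set.
  Hence the excess of \<open>\<bar>\<Union>J\<bar>\<close> over \<open>k + \<bar>J\<bar>\<close> is at least the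
  excess for the full stars, which is positive by the definition of \<open>P(n,k)\<close>.
\<close>

lemma substars_card:
  assumes J: "J \<subseteq> stars" "J \<noteq> {}" and not1: "\<And>S. S \<in> \<T> \<Longrightarrow> \<not> J \<subseteq> star (K S) S"
  shows "k + card J < card (\<Union>J)"
proof -
  define I where "I = {S \<in> \<T>. J \<inter> star (K S) S \<noteq> {}}"
  define b where "b S = card (J \<inter> star (K S) S)" for S
  have IT: "I \<subseteq> \<T>" by (auto simp: I_def)
  have finI: "finite I" using IT Pnk_finite[OF T] finite_subset by blast
  have cov: "J = (\<Union>S\<in>I. J \<inter> star (K S) S)" using J unfolding stars_def I_def by blast
  \<comment> \<open>a collection within a single star is excluded by the hypothesis\<close>
  have two: "2 \<le> card I"
  proof (rule ccontr)
    assume "\<not> 2 \<le> card I"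
    then have "card I \<le> 1" by simp
    then have "\<exists>S. I \<subseteq> {S}" using finI by (simp add: card_le_Suc0_iff_eq) blast
    then obtain S where S: "I \<subseteq> {S}" by blast
    have "I \<noteq> {}" using cov J(2) by (metis UN_empty)
    then have "S \<in> \<T>" using S IT by blast
    then show False using not1 cov S by blast
  qed
  have finJ: "finite J" "finite (\<Union>J)"
    using finite_subset[OF _ ksubsets_finite] finite_Union_ksubsets J(1) stars_ksubsets
    by (metis order_trans)+
  have b: "card (\<Union>(J \<inter> star (K S) S)) = k + b S" "b S \<le> card S - k" if S: "S \<in> I" for S
  proof -
    have S': "S \<in> \<T>" "J \<inter> star (K S) S \<noteq> {}" using S by (auto simp: I_def)
    show "card (\<Union>(J \<inter> star (K S) S)) = k + b S"
      using star_Union_card[OF PnkD(3)[OF T S'(1)] K(1)[OF S'(1)] Int_lower2 S'(2)] K(2)[OF S'(1)]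
      by (simp add: b_def)
    have "finite (star (K S) S)" using PnkD(3)[OF T S'(1)] by (simp add: star_def)
    then have "b S \<le> card (star (K S) S)" unfolding b_def by (intro card_mono) auto
    then show "b S \<le> card S - k"
      using card_star[OF PnkD(3)[OF T S'(1)] K(1)[OF S'(1)]] K(2)[OF S'(1)] by simp
  qed
  have "card J \<le> (\<Sum>S\<in>I. b S)"
    using card_UN_le[OF finI, of "\<lambda>S. J \<inter> star (K S) S"] cov by (simp add: b_def)
  moreover have "card (\<Union>I) \<le> card (\<Union>J) + (\<Sum>S\<in>I. (card S - k) - b S)"
  proof -
    have "\<Union>I \<subseteq> \<Union>J \<union> (\<Union>S\<in>I. S - \<Union>(J \<inter> star (K S) S))" by auto
    moreover have "finite (\<Union>J \<union> (\<Union>S\<in>I. S - \<Union>(J \<inter> star (K S) S)))"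
      using finJ finI PnkD(3)[OF T] IT by auto
    ultimately have "card (\<Union>I) \<le> card (\<Union>J \<union> (\<Union>S\<in>I. S - \<Union>(J \<inter> star (K S) S)))"
      by (intro card_mono)
    also have "\<dots> \<le> card (\<Union>J) + card (\<Union>S\<in>I. S - \<Union>(J \<inter> star (K S) S))"
      by (rule card_Un_le)
    also have "card (\<Union>S\<in>I. S - \<Union>(J \<inter> star (K S) S)) \<le> (\<Sum>S\<in>I. card (S - \<Union>(J \<inter> star (K S) S)))"
      by (rule card_UN_le[OF finI])
    also have "\<dots> = (\<Sum>S\<in>I. (card S - k) - b S)"
    proof (rule sum.cong)
      fix S assume S: "S \<in> I"
      then have "S \<in> \<T>" using IT by blast
      have "\<Union>(J \<inter> star (K S) S) \<subseteq> S" using K(1)[OF \<open>S \<in> \<T>\<close>] by (auto simp: star_def)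
      then have "card (S - \<Union>(J \<inter> star (K S) S)) = card S - card (\<Union>(J \<inter> star (K S) S))"
        using PnkD(3)[OF T \<open>S \<in> \<T>\<close>] by (intro card_Diff_subset) (auto intro: finite_subset)
      then show "card (S - \<Union>(J \<inter> star (K S) S)) = (card S - k) - b S" using b(1)[OF S] by simp
    qed simp
    finally show ?thesis by simp
  qed
  moreover have "(\<Sum>S\<in>I. (card S - k) - b S) + (\<Sum>S\<in>I. b S) = (\<Sum>S\<in>I. card S - k)"
    unfolding sum.distrib[symmetric] by (intro sum.cong) (simp_all only: le_add_diff_inverse2 b(2))
  moreover have "card (\<Union>I) > k + (\<Sum>S\<in>I. card S - k)"
    using T IT two unfolding Pnk_def by blast
  ultimately show ?thesis by linarith
qed

lemma substar_card:
  assumes "S \<in> \<T>" "J \<subseteq> star (K S) S" "J \<noteq> {}"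
  shows "card (\<Union>J) = k + card J"
  using star_Union_card[OF PnkD(3)[OF T] K(1)] K(2) assms by metis

lemma hall_stars: "hall k stars"
  unfolding hall_def
proof (intro allI impI)
  fix J assume J: "J \<subseteq> stars" "J \<noteq> {}"
  show "k + card J \<le> card (\<Union>J)"
  proof (cases "\<exists>S\<in>\<T>. J \<subseteq> star (K S) S")
    case True
    then obtain S where "S \<in> \<T>" "J \<subseteq> star (K S) S" by blast
    then show ?thesis using substar_card[of S J] J(2) by simp
  next
    case False
    then show ?thesis using substars_card[OF J] by (simp add: less_imp_le)
  qed
qed

lemma star_nonempty: "S \<in> \<T> \<Longrightarrow> star (K S) S \<noteq> {}"
  using PnkD(2)[OF T, of S] K[of S] by (auto simp: star_def)

lemma Union_star: "S \<in> \<T> \<Longrightarrow> \<Union>(star (K S) S) = S"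
  using PnkD(2)[OF T, of S] K[of S] by (intro star_Union) auto

text \<open>
  By \<open>substars_card\<close> every tight subcollection lies within one star, and the full stars are tight.
\<close>

lemma max_tight_stars: "max_tight k stars = (\<lambda>S. star (K S) S) ` \<T>"
proof -
  have tight: "tight k (star (K S) S)" "star (K S) S \<subseteq> stars" if "S \<in> \<T>" for S
    using substar_card[OF that] star_nonempty[OF that] that by (auto simp: tight_def stars_def)
  have sub: "\<exists>S\<in>\<T>. J \<subseteq> star (K S) S" if "J \<subseteq> stars" "tight k J" for J
    using substars_card[of J] that unfolding tight_def by (metis nat_less_le)
  show ?thesis
  proof (intro subset_antisym subsetI)
    fix M assume M: "M \<in> max_tight k stars"
    then have "M \<subseteq> stars" "tight k M" by (simp_all add: max_tight_def)
    then obtain S where S: "S \<in> \<T>" "M \<subseteq> star (K S) S" using sub by blast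
    then have "star (K S) S = M" using M tight[OF S(1)] by (simp add: max_tight_def)
    then show "M \<in> (\<lambda>S. star (K S) S) ` \<T>" using S by blast
  next
    fix M assume "M \<in> (\<lambda>S. star (K S) S) ` \<T>"
    then obtain S where S: "S \<in> \<T>" "M = star (K S) S" by blast
    have "M' = M" if M': "M' \<subseteq> stars" "tight k M'" "M \<subseteq> M'" for M'
    proof -
      obtain S' where S': "S' \<in> \<T>" "M' \<subseteq> star (K S') S'" using sub M' by blast
      have "S \<subseteq> S'"
        using Union_mono[OF order_trans[OF M'(3) S'(2)]] S S' Union_star by simp
      then have "S = S'" using Pnk_antichain[OF T S(1) S'(1)] by blast
      then show ?thesis using S(2) S'(2) M'(3) by simp
    qed
    then show "M \<in> max_tight k stars" using S tight by (simp add: max_tight_def)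
  qed
qed

lemma Union_max_tight_stars: "Union ` max_tight k stars = \<T>"
  unfolding max_tight_stars image_image using Union_star by simp

end

section \<open>Generic choice of vectors\<close>

context vector_space
begin

lemma independent_if_card_le_dim:
  assumes "finite S" "card S \<le> dim S"
  shows "independent S"
proof -
  obtain B where B: "B \<subseteq> S" "independent B" "S \<subseteq> span B" by (rule maximal_independent_subset)
  have "card B = dim S" using B by (intro basis_card_eq_dim)
  then have "B = S" using B(1) assms by (intro card_seteq) auto
  then show ?thesis using B by simp
qed

lemma dim_insert_notin_span:
  assumes "finite S" "v \<notin> span S"
  shows "dim (insert v S) = dim S + 1"
proof -
  obtain B where B: "B \<subseteq> S" "independent B" "S \<subseteq> span B" by (rule maximal_independent_subset)
  have "finite B" using B assms finite_subset by auto
  have "span B = span S" using B span_mono span_minimal subspace_span by (metis subset_antisym)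
  then have v: "v \<notin> span B" using assms by simp
  then have "v \<notin> B" using span_base by blast
  have "card (insert v B) = dim (insert v S)"
  proof (rule basis_card_eq_dim)
    show "insert v S \<subseteq> span (insert v B)"
      using B(3) span_mono[of B "insert v B"] span_base[of v "insert v B"] by auto
    show "independent (insert v B)" using v B by (intro independent_insertI)
  qed (use B in auto)
  moreover have "card B = dim S" using B by (intro basis_card_eq_dim)
  ultimately show ?thesis using \<open>finite B\<close> \<open>v \<notin> B\<close> by simp
qed

lemma dim_mono_finite:
  assumes "finite T" "S \<subseteq> span T"
  shows "dim S \<le> dim T"
proof -
  obtain B where B: "B \<subseteq> T" "independent B" "T \<subseteq> span B" by (rule maximal_independent_subset)
  have "card B = dim T" using B by (intro basis_card_eq_dim)
  moreover have "span T \<subseteq> span B" using B span_minimal subspace_span by blast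
  then have "dim S \<le> card B" using assms B finite_subset by (intro dim_le_card) auto
  ultimately show ?thesis by simp
qed

text \<open>
  On a line \<open>v + t w\<close> through \<open>v\<close>, where \<open>v\<close> avoids the old subspaces and
  \<open>w\<close> avoids the new one, each of the subspaces excludes at most one value of \<open>t\<close>.
\<close>

lemma subspace_not_covered:
  assumes inf: "infinite (UNIV :: 'a set)" and U: "subspace U"
    and P: "finite \<P>" "\<And>P. P \<in> \<P> \<Longrightarrow> subspace P" "\<And>P. P \<in> \<P> \<Longrightarrow> \<not> U \<subseteq> P"
  shows "\<exists>v\<in>U. \<forall>P\<in>\<P>. v \<notin> P"
  using P
proof (induction \<P> rule: finite_induct)
  case empty
  then show ?case using subspace_0[OF U] by blast
next
  case (insert Q \<P>)
  then obtain v where v: "v \<in> U" "\<forall>P\<in>\<P>. v \<notin> P" by blast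
  obtain w where w: "w \<in> U" "w \<notin> Q" using insert.prems(2)[of Q] by blast
  have bad: "finite {t. v + scale t w \<in> P}" if P: "P \<in> insert Q \<P>" for P
  proof -
    have sP: "subspace P" using insert.prems(1) P by blast
    have "s = t" if "v + scale s w \<in> P" "v + scale t w \<in> P" for s t
    proof (rule ccontr)
      assume "s \<noteq> t"
      have "(v + scale s w) - (v + scale t w) \<in> P" using sP that by (rule subspace_diff)
      then have "scale (s - t) w \<in> P" by (simp add: scale_left_diff_distrib)
      then have "scale (inverse (s - t)) (scale (s - t) w) \<in> P" using sP subspace_scale by blast
      then have wP: "w \<in> P" using \<open>s \<noteq> t\<close> by simp
      then have "(v + scale s w) - scale s w \<in> P"
        using that(1) sP subspace_diff subspace_scale by blast
      then have "v \<in> P" by simp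
      then show False using wP v w P by blast
    qed
    then have "\<exists>s. {t. v + scale t w \<in> P} \<subseteq> {s}" by blast
    then show ?thesis using finite_subset by blast
  qed
  have "finite (\<Union>P\<in>insert Q \<P>. {t. v + scale t w \<in> P})" using insert.hyps bad by blast
  then obtain t where "t \<notin> (\<Union>P\<in>insert Q \<P>. {t. v + scale t w \<in> P})"
    using inf ex_new_if_finite by blast
  moreover have "v + scale t w \<in> U" using U v w subspace_add subspace_scale by blast
  ultimately show ?case by blast
qed

text \<open>
  A generic form of Rado's theorem on independent representatives, for several test sets \<open>G a\<close> at once.
  The representatives are chosen one by one. The new vector \<open>v\<close> joins every \<open>G a\<close>, which
  raises the bound by one. This is harmless unless the inequality for some \<open>J\<close> is an equality. In that
  case \<open>span (F l)\<close> is not contained in the span for \<open>J\<close>, by the hypothesis for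
  \<open>insert l J\<close>, so that \<open>v\<close> can be chosen outside it.
\<close>

lemma generic_choice:
  assumes inf: "infinite (UNIV :: 'a set)"
    and fin: "finite I" "\<And>i. i \<in> I \<Longrightarrow> finite (F i)" "finite A" "\<And>a. a \<in> A \<Longrightarrow> finite (G a)"
    and dim: "\<And>a J. a \<in> A \<Longrightarrow> J \<subseteq> I \<Longrightarrow> c + card J \<le> dim (G a \<union> (\<Union>i\<in>J. F i))"
  shows "\<exists>u. (\<forall>i\<in>I. u i \<in> span (F i)) \<and> (\<forall>a\<in>A. c + card I \<le> dim (G a \<union> u ` I))"
  using fin(1,2,4) dim
proof (induction I arbitrary: G c rule: finite_induct)
  case empty
  then show ?case using empty.prems(3)[of _ "{}"] by auto
next
  case (insert l I)
  define S where "S a J = G a \<union> (\<Union>i\<in>J. F i)" for a J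
  have finS: "finite (S a J)" if "a \<in> A" "J \<subseteq> I" for a J
    using that insert.prems(1,2) insert.hyps(1) finite_subset[of J I] by (auto simp: S_def)
  \<comment> \<open>the conditions that hold with equality are the only ones that a bad choice of the new vector can destroy\<close>
  define Bad where "Bad = {(a, J). a \<in> A \<and> J \<subseteq> I \<and> dim (S a J) = c + card J}"
  have "finite Bad"
    using fin(3) insert.hyps(1) by (intro finite_subset[of Bad "A \<times> Pow I"]) (auto simp: Bad_def)
  have notsub: "\<not> span (F l) \<subseteq> span (S a J)" if aJ: "(a, J) \<in> Bad" for a J
  proof
    assume "span (F l) \<subseteq> span (S a J)"
    then have sub: "F l \<subseteq> span (S a J)" using span_superset by blast
    have aJ': "a \<in> A" "J \<subseteq> I" "dim (S a J) = c + card J" using aJ by (auto simp: Bad_def)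
    have J: "finite J" "l \<notin> J" using aJ' insert.hyps finite_subset by auto
    have "c + card (insert l J) \<le> dim (G a \<union> (\<Union>i\<in>insert l J. F i))"
      using aJ' by (intro insert.prems(3)) auto
    also have "\<dots> \<le> dim (S a J)"
    proof (rule dim_mono_finite)
      show "finite (S a J)" using finS aJ' by blast
      show "G a \<union> (\<Union>i\<in>insert l J. F i) \<subseteq> span (S a J)"
        using sub span_superset[of "S a J"] by (auto simp: S_def)
    qed
    finally show False using aJ' J by simp
  qed
  obtain v where v: "v \<in> span (F l)" "\<And>a J. (a, J) \<in> Bad \<Longrightarrow> v \<notin> span (S a J)"
    using subspace_not_covered[OF inf subspace_span, of "(\<lambda>(a, J). span (S a J)) ` Bad" "F l"]
      \<open>finite Bad\<close> notsub by force
  have "\<exists>u. (\<forall>i\<in>I. u i \<in> span (F i)) \<and> (\<forall>a\<in>A. (c + 1) + card I \<le> dim (insert v (G a) \<union> u ` I))"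
  proof (rule insert.IH)
    fix a J assume aJ: "a \<in> A" "J \<subseteq> I"
    have eq: "insert v (G a) \<union> (\<Union>i\<in>J. F i) = insert v (S a J)" by (auto simp: S_def)
    have le: "c + card J \<le> dim (S a J)" unfolding S_def using aJ by (intro insert.prems(3)) auto
    show "(c + 1) + card J \<le> dim (insert v (G a) \<union> (\<Union>i\<in>J. F i))"
    proof (cases "dim (S a J) = c + card J")
      case True
      then have "(a, J) \<in> Bad" using aJ by (simp add: Bad_def)
      then show ?thesis unfolding eq using dim_insert_notin_span[OF finS[OF aJ] v(2)] le by simp
    next
      case False
      have "dim (S a J) \<le> dim (insert v (S a J))"
        using finS[OF aJ] span_superset[of "insert v (S a J)"] by (intro dim_mono_finite) auto
      then show ?thesis unfolding eq using False le by simp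
    qed
  qed (use insert.prems in auto)
  then obtain u where u: "\<forall>i\<in>I. u i \<in> span (F i)"
    "\<forall>a\<in>A. (c + 1) + card I \<le> dim (insert v (G a) \<union> u ` I)" by blast
  have "(u(l := v)) ` insert l I = insert v (u ` I)" using insert.hyps(2) by auto
  then have "G a \<union> (u(l := v)) ` insert l I = insert v (G a) \<union> u ` I" for a by auto
  then show ?case using u v insert.hyps by (intro exI[of _ "u(l := v)"]) auto
qed

lemma span_Int_disjoint:
  assumes "independent (A \<union> B)" "finite A" "finite B" "A \<inter> B = {}" "x \<in> span A" "x \<in> span B"
  shows "x = 0"
proof -
  obtain a where a: "x = (\<Sum>v\<in>A. scale (a v) v)" using assms by (auto simp: span_finite)
  obtain b where b: "x = (\<Sum>v\<in>B. scale (b v) v)" using assms by (auto simp: span_finite)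
  define c where "c v = (if v \<in> A then a v else - b v)" for v
  have "(\<Sum>v\<in>A. scale (c v) v) = x" unfolding a c_def by (intro sum.cong) auto
  moreover have "(\<Sum>v\<in>B. scale (c v) v) = (\<Sum>v\<in>B. - scale (b v) v)"
    unfolding c_def using assms(4) by (intro sum.cong) auto
  ultimately have "(\<Sum>v\<in>A \<union> B. scale (c v) v) = 0"
    using assms(2-4) b by (simp add: sum.union_disjoint sum_negf)
  then have "c v = 0" if "v \<in> A" for v
    using independentD[OF assms(1), of "A \<union> B" c v] assms(2,3) that by simp
  then have "a v = 0" if "v \<in> A" for v using that by (metis c_def)
  then show ?thesis unfolding a by simp
qed

end

text \<open>
  Rows are treated as real functions on the natural numbers that vanish outside \<open>{..<n}\<close>. They then lie
  in one vector space that is a whole type, whatever \<open>n\<close> is.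
\<close>

definition fscale :: "real \<Rightarrow> (nat \<Rightarrow> real) \<Rightarrow> nat \<Rightarrow> real" where
  "fscale c f = (\<lambda>x. c * f x)"

interpretation FV: vector_space fscale
  by unfold_locales (auto simp: fscale_def fun_eq_iff algebra_simps)

interpretation FVP: vector_space_pair fscale fscale ..

definition supp_on :: "nat set \<Rightarrow> (nat \<Rightarrow> real) set" where
  "supp_on S = {f. \<forall>x. x \<notin> S \<longrightarrow> f x = 0}"

definition unit_fun :: "nat \<Rightarrow> nat \<Rightarrow> real" where
  "unit_fun i = (\<lambda>j. if j = i then 1 else 0)"

lemma sum_fun_apply: "(\<Sum>i\<in>I. f i) x = (\<Sum>i\<in>I. (f i x :: real))"
  by (induction I rule: infinite_finite_induct) auto

lemma subspace_supp_on: "FV.subspace (supp_on S)"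
  by (auto simp: FV.subspace_def supp_on_def fscale_def)

lemma supp_on_expand:
  assumes "finite S" "f \<in> supp_on S"
  shows "f = (\<Sum>i\<in>S. fscale (f i) (unit_fun i))"
proof
  fix x
  have "(\<Sum>i\<in>S. fscale (f i) (unit_fun i)) x = (\<Sum>i\<in>S. if i = x then f i else 0)"
    unfolding sum_fun_apply by (intro sum.cong) (auto simp: unit_fun_def fscale_def)
  also have "\<dots> = f x" using assms by (auto simp: supp_on_def)
  finally show "f x = (\<Sum>i\<in>S. fscale (f i) (unit_fun i)) x" by simp
qed

lemma span_units:
  assumes "finite S"
  shows "FV.span (unit_fun ` S) = supp_on S"
proof
  show "FV.span (unit_fun ` S) \<subseteq> supp_on S"
    by (intro FV.span_minimal subspace_supp_on) (auto simp: supp_on_def unit_fun_def)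
  show "supp_on S \<subseteq> FV.span (unit_fun ` S)"
  proof
    fix f assume "f \<in> supp_on S"
    then have "f = (\<Sum>i\<in>S. fscale (f i) (unit_fun i))" using assms supp_on_expand by blast
    also have "\<dots> \<in> FV.span (unit_fun ` S)"
      by (intro FV.span_sum FV.span_scale FV.span_base) auto
    finally show "f \<in> FV.span (unit_fun ` S)" .
  qed
qed

lemma inj_unit: "inj_on unit_fun S"
  by (auto simp: inj_on_def unit_fun_def fun_eq_iff split: if_splits)

lemma independent_units:
  assumes "finite S"
  shows "FV.independent (unit_fun ` S)"
  using assms
proof (induction S rule: finite_induct)
  case (insert i S)
  have "unit_fun i \<notin> FV.span (unit_fun ` S)"
    unfolding span_units[OF insert.hyps(1)] using insert.hyps(2) by (auto simp: supp_on_def unit_fun_def)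
  then show ?case using insert.IH by (simp add: FV.independent_insertI)
qed (simp add: FV.independent_empty)

lemma dim_units: "finite S \<Longrightarrow> FV.dim (unit_fun ` S) = card S"
  by (simp add: FV.dim_eq_card_independent independent_units card_image inj_unit)

section \<open>Rows of the discriminantal matrix\<close>

lemma bij_betw_pick:
  assumes "finite S"
  shows "bij_betw (pick S) {..<card S} S"
  unfolding bij_betw_def
proof
  show inj: "inj_on (pick S) {..<card S}"
    using pick_mono[of _ S] by (intro linorder_inj_onI) (auto, metis less_irrefl)
  have "pick S ` {..<card S} \<subseteq> S" using pick_in_set by auto
  then show "pick S ` {..<card S} = S"
    using assms inj by (intro card_subset_eq) (auto simp: card_image)
qed

lemma sum_pick: "finite S \<Longrightarrow> (\<Sum>t<card S. h (pick S t)) = (\<Sum>i\<in>S. h i)"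
  by (rule sum.reindex_bij_betw[OF bij_betw_pick])

lemma pick_surj:
  assumes "finite S" "i \<in> S"
  obtains t where "t < card S" "pick S t = i"
  using bij_betw_imp_surj_on[OF bij_betw_pick[OF assms(1)]] assms(2) by (metis imageE lessThan_iff)

lemma vec_to_fun:
  assumes "finite S"
  obtains f :: "nat \<Rightarrow> real" where "f \<in> supp_on S" "\<And>t. t < card S \<Longrightarrow> f (pick S t) = v t"
proof
  let ?f = "\<lambda>x. if x \<in> S then v (inv_into {..<card S} (pick S) x) else 0"
  show "?f \<in> supp_on S" by (simp add: supp_on_def)
  show "?f (pick S t) = v t" if "t < card S" for t
  proof -
    have "pick S t \<in> S" using pick_in_set that by blast
    moreover have "inv_into {..<card S} (pick S) (pick S t) = t"
      using bij_betw_inv_into_left[OF bij_betw_pick[OF assms]] that by simp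
    ultimately show ?thesis by simp
  qed
qed

text \<open>
  This turns nonvanishing of a determinant into the uniqueness of a solution, so that no signs or index shifts of
  cofactors need to be followed below.
\<close>

lemma singular_left_kernel:
  fixes M :: "real mat"
  assumes "M \<in> carrier_mat m m"
  shows "det M = 0 \<longleftrightarrow> (\<exists>v\<in>carrier_vec m. v \<noteq> 0\<^sub>v m \<and> (\<forall>j<m. (\<Sum>i<m. v $ i * M $$ (i, j)) = 0))"
proof -
  have T: "M\<^sup>T \<in> carrier_mat m m" using assms by simp
  have *: "M\<^sup>T *\<^sub>v v = 0\<^sub>v m \<longleftrightarrow> (\<forall>j<m. (\<Sum>i<m. v $ i * M $$ (i, j)) = 0)"
    if v: "v \<in> carrier_vec m" for v
  proof -
    have "(M\<^sup>T *\<^sub>v v) $ j = (\<Sum>i<m. v $ i * M $$ (i, j))" if "j < m" for j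
      using assms v that
      by (auto simp: scalar_prod_def lessThan_atLeast0 mult.commute intro!: sum.cong)
    moreover have "dim_vec (M\<^sup>T *\<^sub>v v) = m" using assms by simp
    ultimately show ?thesis by (auto simp: vec_eq_iff)
  qed
  have "det M = det M\<^sup>T" using det_transpose[OF assms] by simp
  also have "\<dots> = 0 \<longleftrightarrow> (\<exists>v. v \<in> carrier_vec m \<and> v \<noteq> 0\<^sub>v m \<and> M\<^sup>T *\<^sub>v v = 0\<^sub>v m)"
    by (rule det_0_iff_vec_prod_zero[OF T])
  finally show ?thesis using * by blast
qed

definition col_orth :: "nat \<Rightarrow> nat \<Rightarrow> real mat \<Rightarrow> (nat \<Rightarrow> real) set" where
  "col_orth n k X = {f. \<forall>j<k. (\<Sum>i<n. f i * X $$ (i, j)) = 0}"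

text \<open>
  All maximal minors of the matrix are nonzero, expressed by the absence of linear relations among any
  \<open>k\<close> rows.
\<close>

definition uniform_mat :: "nat \<Rightarrow> nat \<Rightarrow> real mat \<Rightarrow> bool" where
  "uniform_mat n k X \<longleftrightarrow> (\<forall>K\<in>ksubsets n k. supp_on K \<inter> col_orth n k X \<subseteq> {0})"

definition disc_fun :: "nat \<Rightarrow> nat \<Rightarrow> real mat \<Rightarrow> nat set \<Rightarrow> nat \<Rightarrow> real" where
  "disc_fun n k X E = (\<lambda>i. if i < n then disc_row n k X E $ i else 0)"

lemma subspace_col_orth: "FV.subspace (col_orth n k X)"
  by (auto simp: FV.subspace_def col_orth_def fscale_def algebra_simps sum.distrib
      sum_distrib_left[symmetric])

lemma sum_supp:
  assumes "f \<in> supp_on S" "S \<subseteq> {..<n}"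
  shows "(\<Sum>i<n. f i * (g i :: real)) = (\<Sum>i\<in>S. f i * g i)"
  using assms by (intro sum.mono_neutral_right) (auto simp: supp_on_def)

lemma uniform_mat_of_dets:
  assumes X: "X \<in> carrier_mat n k" and det: "\<And>I. I \<in> ksubsets n k \<Longrightarrow> det (submatrix X I UNIV) \<noteq> 0"
  shows "uniform_mat n k X"
  unfolding uniform_mat_def
proof (intro ballI subsetI)
  fix K f assume K: "K \<in> ksubsets n k" and f: "f \<in> supp_on K \<inter> col_orth n k X"
  note K' = ksubsetsD[OF K]
  let ?M = "submatrix X K UNIV"
  have eq: "{i. i < dim_row X \<and> i \<in> K} = K" "{j. j < dim_col X \<and> j \<in> UNIV} = {..<k}"
    using X K' by auto
  have M: "?M \<in> carrier_mat k k"
    by (rule carrier_matI) (simp_all only: dim_submatrix eq K' card_lessThan)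
  have Mij: "?M $$ (t, j) = X $$ (pick K t, j)" if "t < k" "j < k" for t j
    using submatrix_index[of t X K j UNIV] that unfolding eq K'(2) by (simp add: pick_UNIV)
  let ?v = "vec k (\<lambda>t. f (pick K t))"
  have "(\<Sum>t<k. ?v $ t * ?M $$ (t, j)) = 0" if j: "j < k" for j
  proof -
    have "(\<Sum>t<k. ?v $ t * ?M $$ (t, j)) = (\<Sum>t<card K. f (pick K t) * X $$ (pick K t, j))"
      unfolding K'(2) using j by (intro sum.cong) (auto simp: Mij)
    also have "\<dots> = (\<Sum>i<n. f i * X $$ (i, j))"
      using sum_pick[OF K'(3), of "\<lambda>i. f i * X $$ (i, j)"] sum_supp[of f K n] f K' by simp
    finally show ?thesis using f j by (simp add: col_orth_def)
  qed
  then have "?v = 0\<^sub>v k" using singular_left_kernel[OF M] det[OF K] by (metis vec_carrier)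
  then have z: "f (pick K t) = 0" if "t < k" for t using that by (metis index_vec index_zero_vec(1))
  have "f i = 0" for i
  proof (cases "i \<in> K")
    case True
    then show ?thesis using pick_surj[OF K'(3) True] z K'(2) by metis
  qed (use f in \<open>auto simp: supp_on_def\<close>)
  then show "f \<in> {0}" by (auto simp: fun_eq_iff)
qed

text \<open>
  Expansion along the last column, whose cofactors do not involve \<open>y\<close>.
\<close>

lemma lin_form_expand:
  fixes X :: "'a::comm_ring_1 mat"
  obtains c where "\<And>y. lin_form k X E y = (\<Sum>t<k + 1. y $ pick E t * c t)"
proof
  let ?M = "\<lambda>y. mat (k + 1) (k + 1) (\<lambda>(t, j). if j < k then X $$ (pick E t, j) else y $ pick E t)"
  let ?c = "\<lambda>t. cofactor (?M (0\<^sub>v 0)) t k"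
  fix y
  have "lin_form k X E y = (\<Sum>t<k + 1. ?M y $$ (t, k) * cofactor (?M y) t k)"
    unfolding lin_form_def by (rule laplace_expansion_column) auto
  also have "\<dots> = (\<Sum>t<k + 1. y $ pick E t * ?c t)"
  proof (rule sum.cong)
    fix t assume "t \<in> {..<k + 1}"
    moreover have "mat_delete (?M y) t k = mat_delete (?M (0\<^sub>v 0)) t k"
      unfolding mat_delete_def by (rule eq_matI) auto
    ultimately show "?M y $$ (t, k) * cofactor (?M y) t k = y $ pick E t * ?c t"
      by (simp add: cofactor_def)
  qed simp
  finally show "lin_form k X E y = (\<Sum>t<k + 1. y $ pick E t * ?c t)" .
qed

lemma lin_form_disc_row:
  fixes X :: "real mat"
  assumes E: "E \<in> ksubsets n (k + 1)"
  shows "lin_form k X E (vec n y) = (\<Sum>i<n. y i * disc_row n k X E $ i)"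
proof -
  obtain c where c: "\<And>y. lin_form k X E y = (\<Sum>t<k + 1. y $ pick E t * c t)"
    using lin_form_expand by blast
  have p: "pick E t < n" if "t < k + 1" for t
    using ksubsetsD[OF E] pick_in_set[of t E] that by auto
  have "(\<Sum>i<n. y i * disc_row n k X E $ i)
      = (\<Sum>i<n. y i * (\<Sum>t<k + 1. unit_vec n i $ pick E t * c t))"
    by (intro sum.cong) (auto simp: disc_row_def c)
  also have "\<dots> = (\<Sum>i<n. \<Sum>t<k + 1. y i * (unit_vec n i $ pick E t * c t))"
    by (simp only: sum_distrib_left)
  also have "\<dots> = (\<Sum>t<k + 1. \<Sum>i<n. y i * (unit_vec n i $ pick E t * c t))"
    by (rule sum.swap)
  also have "\<dots> = (\<Sum>t<k + 1. vec n y $ pick E t * c t)"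
  proof (rule sum.cong)
    fix t assume t: "t \<in> {..<k + 1}"
    have "(\<Sum>i<n. y i * (unit_vec n i $ pick E t * c t))
        = (\<Sum>i<n. if i = pick E t then y i * c t else 0)"
      using p t by (intro sum.cong) (auto simp: unit_vec_def)
    then show "(\<Sum>i<n. y i * (unit_vec n i $ pick E t * c t)) = vec n y $ pick E t * c t"
      using p t by simp
  qed simp
  finally show ?thesis by (simp add: c)
qed

lemma disc_fun_supp:
  assumes E: "E \<in> ksubsets n (k + 1)"
  shows "disc_fun n k X E \<in> supp_on E"
proof -
  have "disc_fun n k X E i = 0" if i: "i \<notin> E" for i
  proof (cases "i < n")
    case True
    obtain c where c: "\<And>y. lin_form k X E y = (\<Sum>t<k + 1. y $ pick E t * c t)"
      using lin_form_expand by blast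
    have "unit_vec n i $ pick E t = (0::real)" if "t < k + 1" for t
      using ksubsetsD[OF E] pick_in_set[of t E] that i True by (auto simp: unit_vec_def)
    then show ?thesis using True by (simp add: disc_fun_def disc_row_def c)
  qed (simp add: disc_fun_def)
  then show ?thesis by (simp add: supp_on_def)
qed

text \<open>
  The scalar product with a column of \<open>X\<close> is the value of the linear form at that column, a determinant
  with two equal columns.
\<close>

lemma disc_fun_col_orth:
  assumes E: "E \<in> ksubsets n (k + 1)" 
  shows "disc_fun n k X E \<in> col_orth n k X"
  unfolding col_orth_def
proof (intro CollectI allI impI)
  fix j assume j: "j < k"
  have p: "pick E t < n" if "t < k + 1" for t
    using ksubsetsD[OF E] pick_in_set[of t E] that by auto
  have "(\<Sum>i<n. disc_fun n k X E i * X $$ (i, j)) = (\<Sum>i<n. X $$ (i, j) * disc_row n k X E $ i)"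
    by (intro sum.cong) (auto simp: disc_fun_def)
  also have "\<dots> = lin_form k X E (vec n (\<lambda>i. X $$ (i, j)))"
    using lin_form_disc_row[OF E] by simp
  also have "\<dots> = 0"
    unfolding lin_form_def
  proof (rule det_identical_columns[of _ "k + 1" j k])
    show "col (mat (k + 1) (k + 1) (\<lambda>(t, ja). if ja < k then X $$ (pick E t, ja)
        else vec n (\<lambda>i. X $$ (i, j)) $ pick E t)) j =
      col (mat (k + 1) (k + 1) (\<lambda>(t, ja). if ja < k then X $$ (pick E t, ja)
        else vec n (\<lambda>i. X $$ (i, j)) $ pick E t)) k"
      using j p by (intro eq_vecI) auto
  qed (use j in auto)
  finally show "(\<Sum>i<n. disc_fun n k X E i * X $$ (i, j)) = 0" .
qed

text \<open>
  Were the determinant zero, a left kernel vector would be a relation among the rows of \<open>X\<close> in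
  \<open>E\<close> that does not involve row \<open>i\<close>.
\<close>

lemma disc_fun_nonzero:
  assumes U: "uniform_mat n k X" and E: "E \<in> ksubsets n (k + 1)" and i: "i \<in> E"
  shows "disc_fun n k X E i \<noteq> 0"
proof
  assume z: "disc_fun n k X E i = 0"
  note E' = ksubsetsD[OF E]
  have "i < n" using i E' by auto
  \<comment> \<open>the matrix of which entry \<open>i\<close> of the row is the determinant\<close>
  let ?M = "mat (k + 1) (k + 1) (\<lambda>(t, j). if j < k then X $$ (pick E t, j)
      else (unit_vec n i :: real vec) $ pick E t)"
  have "det ?M = 0" using z \<open>i < n\<close> by (simp add: disc_fun_def disc_row_def lin_form_def)
  moreover have "?M \<in> carrier_mat (k + 1) (k + 1)" by simp
  ultimately obtain v where v: "v \<in> carrier_vec (k + 1)" "v \<noteq> 0\<^sub>v (k + 1)"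
    "\<And>j. j < k + 1 \<Longrightarrow> (\<Sum>t<k + 1. v $ t * ?M $$ (t, j)) = 0"
    using singular_left_kernel by blast
  obtain f where f: "f \<in> supp_on E" "\<And>t. t < card E \<Longrightarrow> f (pick E t) = v $ t"
    using vec_to_fun[OF E'(3)] by metis
  have p: "pick E t < n" if "t < k + 1" for t
    using E' pick_in_set[of t E] that by auto
  have s: "(\<Sum>t<k + 1. v $ t * h (pick E t)) = (\<Sum>x<n. f x * h x)" for h
  proof -
    have "(\<Sum>t<k + 1. v $ t * h (pick E t)) = (\<Sum>t<card E. f (pick E t) * h (pick E t))"
      unfolding E'(2) by (intro sum.cong) (auto simp: f E')
    also have "\<dots> = (\<Sum>x<n. f x * h x)"
      using sum_pick[OF E'(3), of "\<lambda>x. f x * h x"] sum_supp[OF f(1) E'(1)] by simp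
    finally show ?thesis .
  qed
  have "(\<Sum>x<n. f x * X $$ (x, j)) = 0" if j: "j < k" for j
  proof -
    have "(\<Sum>t<k + 1. v $ t * ?M $$ (t, j)) = (\<Sum>t<k + 1. v $ t * X $$ (pick E t, j))"
      using j by (intro sum.cong) auto
    then show ?thesis using v(3)[of j] s[of "\<lambda>x. X $$ (x, j)"] j by simp
  qed
  then have orth: "f \<in> col_orth n k X" by (simp add: col_orth_def)
  have "(\<Sum>t<k + 1. v $ t * ?M $$ (t, k)) = (\<Sum>t<k + 1. v $ t * (if pick E t = i then 1 else 0))"
    using p \<open>i < n\<close> by (intro sum.cong) (auto simp: unit_vec_def)
  also have "\<dots> = (\<Sum>x<n. f x * (if x = i then 1 else 0))" by (rule s)
  also have "\<dots> = f i" using \<open>i < n\<close> by (simp add: if_distrib cong: if_cong)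
  finally have "f i = 0" using v(3)[of k] by simp
  then have "f \<in> supp_on (E - {i})" using f by (auto simp: supp_on_def)
  moreover have "E - {i} \<in> ksubsets n k" using E E' i by (auto simp: ksubsets_def)
  ultimately have "f = 0" using U orth unfolding uniform_mat_def by blast
  then have "v $ t = 0" if "t < k + 1" for t using f(2)[of t] that E' by simp
  then have "v = 0\<^sub>v (k + 1)" using v(1) by (intro eq_vecI) auto
  then show False using v by simp
qed

lemma inj_on_disc_fun:
  assumes "uniform_mat n k X"
  shows "inj_on (disc_fun n k X) (ksubsets n (k + 1))"
proof (rule inj_onI)
  have *: "E = {i. disc_fun n k X E i \<noteq> 0}" if "E \<in> ksubsets n (k + 1)" for E
    using disc_fun_supp[OF that, of X] disc_fun_nonzero[OF assms that] by (auto simp: supp_on_def)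
  fix E E' assume "E \<in> ksubsets n (k + 1)" "E' \<in> ksubsets n (k + 1)" "disc_fun n k X E = disc_fun n k X E'"
  then show "E = E'" using * by metis
qed

text \<open>
  Subtracting suitable multiples of the rows of the star removes all entries outside \<open>K\<close>, and what
  remains vanishes by uniformity.
\<close>

lemma span_star:
  assumes U: "uniform_mat n k X" and M: "M \<subseteq> {..<n}" "K \<subseteq> M" "card K = k"
    and f: "f \<in> supp_on M" "f \<in> col_orth n k X"
  shows "f \<in> FV.span (disc_fun n k X ` star K M)"
proof -
  let ?r = "\<lambda>x. disc_fun n k X (insert x K)"
  have fin: "finite M" using M finite_subset by blast
  have E: "insert x K \<in> ksubsets n (k + 1)" if "x \<in> M - K" for x
    using M that finite_subset[OF M(2) fin] by (auto simp: ksubsets_def)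
  \<comment> \<open>each summand cancels the entry of \<open>f\<close> at \<open>x\<close> and has no other entry outside \<open>K\<close>\<close>
  define g where "g = f - (\<Sum>x\<in>M - K. fscale (f x / ?r x x) (?r x))"
  have gy: "g y = f y - (\<Sum>x\<in>M - K. f x / ?r x x * ?r x y)" for y
    by (simp add: g_def sum_fun_apply fscale_def)
  have rz: "?r x y = 0" if "x \<in> M - K" "y \<notin> insert x K" for x y
    using disc_fun_supp[OF E[OF that(1)], of X] that(2) by (auto simp: supp_on_def)
  have "g y = 0" if y: "y \<notin> K" for y
  proof (cases "y \<in> M")
    case False
    then have "f y = 0" using f by (simp add: supp_on_def)
    moreover have "(\<Sum>x\<in>M - K. f x / ?r x x * ?r x y) = 0"
      using False y by (intro sum.neutral ballI) (auto intro: rz)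
    ultimately show ?thesis by (simp add: gy)
  next
    case True
    have "(\<Sum>x\<in>M - K. f x / ?r x x * ?r x y) = (\<Sum>x\<in>M - K. if x = y then f y else 0)"
    proof (rule sum.cong)
      fix x assume x: "x \<in> M - K"
      show "f x / ?r x x * ?r x y = (if x = y then f y else 0)"
        using rz[OF x, of y] y disc_fun_nonzero[OF U E[OF x], of x] by auto
    qed simp
    also have "\<dots> = f y" using True y fin by simp
    finally show ?thesis by (simp add: gy)
  qed
  then have "g \<in> supp_on K" by (simp add: supp_on_def)
  moreover have "g \<in> col_orth n k X"
    unfolding g_def using f(2) E disc_fun_col_orth
    by (intro FV.subspace_diff FV.subspace_sum FV.subspace_scale subspace_col_orth) auto
  moreover have "K \<in> ksubsets n k" using M by (auto simp: ksubsets_def)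
  ultimately have "g = 0" using U unfolding uniform_mat_def by blast
  then have "f = (\<Sum>x\<in>M - K. fscale (f x / ?r x x) (?r x))" by (simp add: g_def)
  also have "\<dots> \<in> FV.span (disc_fun n k X ` star K M)"
    by (intro FV.span_sum FV.span_scale FV.span_base) (auto simp: star_def)
  finally show ?thesis .
qed

text \<open>
  All rows of \<open>J\<close> lie in the span of a star with \<open>\<bar>\<Union>J\<bar> - k\<close> members.
\<close>

lemma independent_imp_hall:
  assumes U: "uniform_mat n k X" and F: "\<F> \<subseteq> ksubsets n (k + 1)"
    and ind: "FV.independent (disc_fun n k X ` \<F>)"
  shows "hall k \<F>"
  unfolding hall_def
proof (intro allI impI)
  fix J assume J: "J \<subseteq> \<F>" "J \<noteq> {}"
  let ?M = "\<Union>J"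
  have J': "J \<subseteq> ksubsets n (k + 1)" using J F by blast
  have M: "?M \<subseteq> {..<n}" "finite ?M" using Union_ksubsets_le[OF J'] finite_Union_ksubsets[OF J'] .
  obtain E where E: "E \<in> J" using J by blast
  have "card E \<le> card ?M" using E M by (intro card_mono) auto
  moreover have "card E = k + 1" using E J' ksubsetsD by blast
  ultimately have Mk: "k \<le> card ?M" by simp
  then obtain K where K: "K \<subseteq> ?M" "card K = k" using obtain_subset_with_card_n by metis
  have "disc_fun n k X ` J \<subseteq> FV.span (disc_fun n k X ` star K ?M)"
  proof
    fix f assume "f \<in> disc_fun n k X ` J"
    then obtain E where E: "E \<in> J" "f = disc_fun n k X E" by blast
    then have "f \<in> supp_on ?M" using disc_fun_supp[of E n k X] J' unfolding supp_on_def by blast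
    moreover have "f \<in> col_orth n k X" using disc_fun_col_orth E J' by blast
    ultimately show "f \<in> FV.span (disc_fun n k X ` star K ?M)" by (rule span_star[OF U M(1) K])
  qed
  moreover have "FV.independent (disc_fun n k X ` J)" using FV.independent_mono[OF ind] J by blast
  moreover have fin: "finite (star K ?M)" using M by (simp add: star_def)
  ultimately have "card (disc_fun n k X ` J) \<le> card (disc_fun n k X ` star K ?M)"
    using FV.independent_span_bound by blast
  also have "\<dots> \<le> card (star K ?M)" using fin by (rule card_image_le)
  also have "\<dots> = card ?M - k" using card_star[OF M(2) K(1)] K by simp
  finally have "card (disc_fun n k X ` J) \<le> card ?M - k" .
  moreover have "card (disc_fun n k X ` J) = card J"
    using inj_on_subset[OF inj_on_disc_fun[OF U] J'] by (rule card_image)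
  ultimately show "k + card J \<le> card ?M" using Mk by simp
qed

lemma proportional_disc_fun:
  assumes U: "uniform_mat n k X" and E: "E \<in> ksubsets n (k + 1)"
    and u: "u \<in> supp_on E" "u \<in> col_orth n k X" "u \<noteq> 0"
  obtains c where "c \<noteq> 0" "u = fscale c (disc_fun n k X E)"
proof -
  have "E \<noteq> {}" using ksubsetsD[OF E] by auto
  then obtain j where j: "j \<in> E" by blast
  let ?r = "disc_fun n k X E"
  define c where "c = u j / ?r j"
  let ?g = "u - fscale c ?r"
  have "?g j = 0" using disc_fun_nonzero[OF U E j] by (simp add: c_def fscale_def)
  moreover have "?g \<in> supp_on E"
    by (intro FV.subspace_diff FV.subspace_scale subspace_supp_on u disc_fun_supp E)
  ultimately have "?g \<in> supp_on (E - {j})" by (auto simp: supp_on_def)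
  moreover have "?g \<in> col_orth n k X"
    by (intro FV.subspace_diff FV.subspace_scale subspace_col_orth u disc_fun_col_orth E)
  moreover have "E - {j} \<in> ksubsets n k" using E j ksubsetsD[OF E] by (auto simp: ksubsets_def)
  ultimately have "?g = 0" using U unfolding uniform_mat_def by blast
  then have "u = fscale c ?r" by simp
  moreover have "c \<noteq> 0"
  proof
    assume "c = 0"
    then have "u = 0" using \<open>u = fscale c ?r\<close> by simp
    then show False using u by simp
  qed
  ultimately show ?thesis using that by blast
qed

section \<open>Evaluation of polynomials and minors\<close>

definition mon_val :: "(nat \<times> nat \<Rightarrow> real) \<Rightarrow> ((nat \<times> nat) \<Rightarrow>\<^sub>0 nat) \<Rightarrow> real" where
  "mon_val \<phi> m = (\<Prod>x\<in>Poly_Mapping.keys m. \<phi> x ^ Poly_Mapping.lookup m x)"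

definition poly_val :: "(nat \<times> nat \<Rightarrow> real) \<Rightarrow> xpoly \<Rightarrow> real" where
  "poly_val \<phi> p = (\<Sum>m\<in>Poly_Mapping.keys p. Poly_Mapping.lookup p m * mon_val \<phi> m)"

lemma mon_val_superset:
  assumes "finite A" "Poly_Mapping.keys m \<subseteq> A"
  shows "mon_val \<phi> m = (\<Prod>x\<in>A. \<phi> x ^ Poly_Mapping.lookup m x)"
  unfolding mon_val_def using assms
  by (intro prod.mono_neutral_left) (auto simp: in_keys_iff)

lemma mon_val_add: "mon_val \<phi> (m + m') = mon_val \<phi> m * mon_val \<phi> m'"
proof -
  let ?A = "Poly_Mapping.keys m \<union> Poly_Mapping.keys m'"
  have "mon_val \<phi> (m + m') = (\<Prod>x\<in>?A. \<phi> x ^ Poly_Mapping.lookup (m + m') x)"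
    by (rule mon_val_superset) (simp_all add: keys_add)
  also have "\<dots> = mon_val \<phi> m * mon_val \<phi> m'"
    by (simp add: mon_val_superset[of ?A m] mon_val_superset[of ?A m'] lookup_add power_add prod.distrib)
  finally show ?thesis .
qed

lemma poly_val_superset:
  assumes "finite A" "Poly_Mapping.keys p \<subseteq> A"
  shows "poly_val \<phi> p = (\<Sum>m\<in>A. Poly_Mapping.lookup p m * mon_val \<phi> m)"
  unfolding poly_val_def using assms
  by (intro sum.mono_neutral_left) (auto simp: in_keys_iff)

lemma poly_val_add: "poly_val \<phi> (p + q) = poly_val \<phi> p + poly_val \<phi> q"
proof -
  let ?A = "Poly_Mapping.keys p \<union> Poly_Mapping.keys q"
  have "poly_val \<phi> (p + q) = (\<Sum>m\<in>?A. Poly_Mapping.lookup (p + q) m * mon_val \<phi> m)"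
    by (rule poly_val_superset) (simp_all add: keys_add)
  also have "\<dots> = poly_val \<phi> p + poly_val \<phi> q"
    by (simp add: poly_val_superset[of ?A p] poly_val_superset[of ?A q] lookup_add algebra_simps sum.distrib)
  finally show ?thesis .
qed

lemma poly_val_0: "poly_val \<phi> 0 = 0"
  by (simp add: poly_val_def)

lemma poly_val_sum: "poly_val \<phi> (\<Sum>i\<in>I. f i) = (\<Sum>i\<in>I. poly_val \<phi> (f i))"
  by (induction I rule: infinite_finite_induct) (simp_all add: poly_val_add poly_val_0)

lemma poly_val_single: "poly_val \<phi> (Poly_Mapping.single m c) = c * mon_val \<phi> m"
  by (simp add: poly_val_def)

lemma sum_monomials:
  "(p :: xpoly) = (\<Sum>m\<in>Poly_Mapping.keys p. Poly_Mapping.single m (Poly_Mapping.lookup p m))"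
proof (rule poly_mapping_eqI)
  fix m
  have "Poly_Mapping.lookup (\<Sum>m\<in>Poly_Mapping.keys p. Poly_Mapping.single m (Poly_Mapping.lookup p m)) m
      = (\<Sum>m'\<in>Poly_Mapping.keys p. if m' = m then Poly_Mapping.lookup p m' else 0)"
    unfolding lookup_sum by (intro sum.cong) (auto simp: lookup_single when_def)
  also have "\<dots> = Poly_Mapping.lookup p m" by (simp add: in_keys_iff)
  finally show "Poly_Mapping.lookup p m = Poly_Mapping.lookup
      (\<Sum>m\<in>Poly_Mapping.keys p. Poly_Mapping.single m (Poly_Mapping.lookup p m)) m" by simp
qed

lemma poly_val_mult: "poly_val \<phi> (p * q) = poly_val \<phi> p * poly_val \<phi> q"
proof -
  let ?p = "Poly_Mapping.lookup p" and ?q = "Poly_Mapping.lookup q"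
  have "p * q = (\<Sum>m\<in>Poly_Mapping.keys p. Poly_Mapping.single m (?p m)) *
      (\<Sum>m\<in>Poly_Mapping.keys q. Poly_Mapping.single m (?q m))"
    using sum_monomials[of p] sum_monomials[of q] by simp
  also have "\<dots> = (\<Sum>m\<in>Poly_Mapping.keys p. \<Sum>m'\<in>Poly_Mapping.keys q.
      Poly_Mapping.single (m + m') (?p m * ?q m'))"
    by (simp only: sum_product mult_single)
  finally have "p * q = \<dots>" .
  then have "poly_val \<phi> (p * q) = (\<Sum>m\<in>Poly_Mapping.keys p. \<Sum>m'\<in>Poly_Mapping.keys q.
      (?p m * mon_val \<phi> m) * (?q m' * mon_val \<phi> m'))"
    by (simp add: poly_val_sum poly_val_single mon_val_add mult_ac)
  also have "\<dots> = poly_val \<phi> p * poly_val \<phi> q"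
    unfolding poly_val_def by (simp add: sum_product)
  finally show ?thesis .
qed

lemma poly_val_1: "poly_val \<phi> 1 = 1"
  using poly_val_single[of \<phi> 0 1] by (simp add: mon_val_def)

lemma poly_val_indet: "poly_val \<phi> (indet i j) = \<phi> (i, j)"
  unfolding indet_def poly_val_single by (simp add: mon_val_def)

lemma poly_val_hom: "comm_ring_hom (poly_val \<phi>)"
  by unfold_locales (auto simp: poly_val_add poly_val_mult poly_val_0 poly_val_1)

context comm_ring_hom
begin

lemma hom_lin_form:
  assumes "X \<in> carrier_mat n k" "y \<in> carrier_vec n" "E \<in> ksubsets n (k + 1)"
  shows "lin_form k (map_mat hom X) E (map_vec hom y) = hom (lin_form k X E y)"
proof -
  have p: "pick E t < n" if "t < k + 1" for t
    using ksubsetsD[OF assms(3)] pick_in_set[of t E] that by auto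
  show ?thesis
    unfolding lin_form_def hom_det[symmetric]
    using p assms by (intro arg_cong[where f = det] eq_matI) auto
qed

lemma hom_disc_submatrix:
  assumes X: "X \<in> carrier_mat n k" and Ss: "set Ss \<subseteq> ksubsets n (k + 1)"
  shows "disc_submatrix n k (map_mat hom X) Ss = map_mat hom (disc_submatrix n k X Ss)"
proof -
  have row: "disc_row n k (map_mat hom X) E = map_vec hom (disc_row n k X E)"
    if E: "E \<in> ksubsets n (k + 1)" for E
  proof (rule eq_vecI)
    fix j assume "j < dim_vec (map_vec hom (disc_row n k X E))"
    then have j: "j < n" by (simp add: disc_row_def)
    have "map_vec hom (unit_vec n j) = unit_vec n j"
      by (rule eq_vecI) (auto simp: unit_vec_def)
    then show "disc_row n k (map_mat hom X) E $ j = map_vec hom (disc_row n k X E) $ j"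
      using j hom_lin_form[OF X _ E, of "unit_vec n j"] by (simp add: disc_row_def)
  qed (simp add: disc_row_def)
  have "disc_row n k (map_mat hom X) (Ss ! i) = map_vec hom (disc_row n k X (Ss ! i))"
    if "i < length Ss" for i
    using row Ss nth_mem[OF that] by blast
  moreover have "dim_vec (disc_row n k X E) = n" for E by (simp add: disc_row_def)
  ultimately show ?thesis
    unfolding disc_submatrix_def by (intro eq_matI) (simp_all add: mat_of_rows_def)
qed

lemma hom_sum_sq_minors:
  assumes X: "X \<in> carrier_mat n k" and Ss: "set Ss \<subseteq> ksubsets n (k + 1)"
  shows "sum_sq_minors n k Ss (map_mat hom X) = hom (sum_sq_minors n k Ss X)"
proof -
  let ?M = "disc_submatrix n k X Ss"
  have "submatrix (map_mat hom ?M) UNIV J = map_mat hom (submatrix ?M UNIV J)" for J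
  proof (rule eq_matI)
    fix i j assume "i < dim_row (map_mat hom (submatrix ?M UNIV J))"
      "j < dim_col (map_mat hom (submatrix ?M UNIV J))"
    then have ij: "i < card {i. i < dim_row ?M \<and> i \<in> UNIV}" "j < card {j. j < dim_col ?M \<and> j \<in> J}"
      by (simp_all add: dim_submatrix)
    have "pick UNIV i < dim_row ?M" "pick J j < dim_col ?M"
      using ij pick_le by blast+
    then show "submatrix (map_mat hom ?M) UNIV J $$ (i, j) = map_mat hom (submatrix ?M UNIV J) $$ (i, j)"
      using ij submatrix_index[of i ?M UNIV j J] submatrix_index[of i "map_mat hom ?M" UNIV j J]
      by (simp add: dim_submatrix)
  qed (simp_all add: dim_submatrix)
  then show ?thesis
    unfolding sum_sq_minors_def hom_disc_submatrix[OF assms]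
    by (simp add: hom_sum hom_power)
qed

end

text \<open>
  Evaluation at \<open>X\<close> shows that \<open>P\<^sub>\<S>\<close> is not the zero polynomial once its value at
  \<open>X\<close> is nonzero.
\<close>

lemma sum_sq_minors_indet:
  assumes X: "X \<in> carrier_mat n k" and Ss: "set Ss \<subseteq> ksubsets n (k + 1)"
  shows "sum_sq_minors n k Ss X = poly_val (\<lambda>ij. X $$ ij) (sum_sq_minors n k Ss (indet_mat n k))"
proof -
  interpret comm_ring_hom "poly_val (\<lambda>ij. X $$ ij)" by (rule poly_val_hom)
  have "map_mat (poly_val (\<lambda>ij. X $$ ij)) (indet_mat n k) = X"
    using X by (intro eq_matI) (auto simp: indet_mat_def poly_val_indet)
  then show ?thesis
    using hom_sum_sq_minors[OF _ Ss, of "indet_mat n k"] by (simp add: indet_mat_def)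
qed

lemma minor_nonzero_iff:
  fixes X :: "real mat"
  assumes Ss: "distinct Ss" and J: "J \<in> ksubsets n (length Ss)"
  shows "det (submatrix (disc_submatrix n k X Ss) UNIV J) \<noteq> 0 \<longleftrightarrow>
    (\<forall>c. (\<forall>i\<in>J. (\<Sum>E\<in>set Ss. c E * disc_fun n k X E i) = 0) \<longrightarrow> (\<forall>E\<in>set Ss. c E = 0))"
proof -
  let ?l = "length Ss" and ?M = "disc_submatrix n k X Ss"
  let ?N = "submatrix ?M UNIV J"
  note J' = ksubsetsD[OF J]
  have dM: "dim_row ?M = ?l" "dim_col ?M = n" by (simp_all add: disc_submatrix_def)
  have eq: "{i. i < dim_row ?M \<and> i \<in> UNIV} = {..<?l}" "{j. j < dim_col ?M \<and> j \<in> J} = J"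
    using dM J' by auto
  have N: "?N \<in> carrier_mat ?l ?l"
    by (rule carrier_matI) (simp_all only: dim_submatrix eq J' card_lessThan)
  have Nst: "?N $$ (s, t) = disc_fun n k X (Ss ! s) (pick J t)" if "s < ?l" "t < ?l" for s t
  proof -
    have p: "pick J t < n" using J' pick_in_set[of t J] that by auto
    have "?N $$ (s, t) = ?M $$ (s, pick J t)"
      using submatrix_index[of s ?M UNIV t J] that unfolding eq J'(2) by (simp add: pick_UNIV)
    then show ?thesis using that p by (simp add: disc_submatrix_def disc_fun_def mat_of_rows_def)
  qed
  have bij: "bij_betw ((!) Ss) {..<?l} (set Ss)" using Ss by (rule bij_betw_nth) auto
  have sum: "(\<Sum>s<?l. h (Ss ! s)) = (\<Sum>E\<in>set Ss. h E)" for h :: "nat set \<Rightarrow> real"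
    by (rule sum.reindex_bij_betw[OF bij])
  have Ncomb: "(\<Sum>s<?l. v $ s * ?N $$ (s, t)) = (\<Sum>E\<in>set Ss. c E * disc_fun n k X E (pick J t))"
    if "t < ?l" "\<And>s. s < ?l \<Longrightarrow> v $ s = c (Ss ! s)" for v c t
    unfolding sum[symmetric] using that by (intro sum.cong) (auto simp: Nst)
  have "det ?N = 0 \<longleftrightarrow>
    (\<exists>c. (\<forall>i\<in>J. (\<Sum>E\<in>set Ss. c E * disc_fun n k X E i) = 0) \<and> (\<exists>E\<in>set Ss. c E \<noteq> 0))"
  proof
    assume "det ?N = 0"
    then obtain v where v: "v \<in> carrier_vec ?l" "v \<noteq> 0\<^sub>v ?l"
      "\<And>t. t < ?l \<Longrightarrow> (\<Sum>s<?l. v $ s * ?N $$ (s, t)) = 0"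
      using singular_left_kernel[OF N] by blast
    define c where "c E = v $ (inv_into {..<?l} ((!) Ss) E)" for E
    have c: "v $ s = c (Ss ! s)" if "s < ?l" for s
      using bij_betw_inv_into_left[OF bij] that by (simp add: c_def)
    have "(\<Sum>E\<in>set Ss. c E * disc_fun n k X E i) = 0" if i: "i \<in> J" for i
    proof -
      obtain t where t: "t < card J" "pick J t = i" using pick_surj[OF J'(3) i] by blast
      have "t < ?l" using t J' by simp
      have "(\<Sum>s<?l. v $ s * ?N $$ (s, t)) = (\<Sum>E\<in>set Ss. c E * disc_fun n k X E (pick J t))"
        using Ncomb[OF \<open>t < ?l\<close>, of v c] c by blast
      then show ?thesis using v(3)[OF \<open>t < ?l\<close>] t by simp
    qed
    moreover have "\<exists>s<?l. v $ s \<noteq> 0"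
    proof (rule ccontr)
      assume "\<not> (\<exists>s<?l. v $ s \<noteq> 0)"
      then have "v = 0\<^sub>v ?l" using v(1) by (intro eq_vecI) auto
      then show False using v by simp
    qed
    then obtain s where "s < ?l" "v $ s \<noteq> 0" by blast
    then have "\<exists>E\<in>set Ss. c E \<noteq> 0" using c[of s] by (intro bexI[of _ "Ss ! s"]) auto
    ultimately show "\<exists>c. (\<forall>i\<in>J. (\<Sum>E\<in>set Ss. c E * disc_fun n k X E i) = 0) \<and> (\<exists>E\<in>set Ss. c E \<noteq> 0)"
      by blast
  next
    assume "\<exists>c. (\<forall>i\<in>J. (\<Sum>E\<in>set Ss. c E * disc_fun n k X E i) = 0) \<and> (\<exists>E\<in>set Ss. c E \<noteq> 0)"
    then obtain c where c: "\<And>i. i \<in> J \<Longrightarrow> (\<Sum>E\<in>set Ss. c E * disc_fun n k X E i) = 0"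
      "\<exists>E\<in>set Ss. c E \<noteq> 0" by blast
    let ?v = "vec ?l (\<lambda>s. c (Ss ! s))"
    obtain s where s: "s < ?l" "c (Ss ! s) \<noteq> 0" using c(2) by (metis in_set_conv_nth)
    have "?v \<noteq> 0\<^sub>v ?l"
    proof
      assume "?v = 0\<^sub>v ?l"
      then have "?v $ s = 0" using s by simp
      then show False using s by simp
    qed
    moreover have "(\<Sum>s<?l. ?v $ s * ?N $$ (s, t)) = 0" if t: "t < ?l" for t
    proof -
      have "pick J t \<in> J" using pick_in_set[of t J] t J' by simp
      moreover have "(\<Sum>s<?l. ?v $ s * ?N $$ (s, t)) = (\<Sum>E\<in>set Ss. c E * disc_fun n k X E (pick J t))"
        by (rule Ncomb[OF t]) simp
      ultimately show ?thesis using c(1) by simp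
    qed
    ultimately show "det ?N = 0"
      unfolding singular_left_kernel[OF N] by (intro bexI[of _ ?v] conjI allI impI) simp_all
  qed
  then show ?thesis by blast
qed

lemma independent_of_sum_sq_minors:
  fixes X :: "real mat"
  assumes U: "uniform_mat n k X" and Ss: "distinct Ss" "set Ss \<subseteq> ksubsets n (k + 1)"
    and nz: "sum_sq_minors n k Ss X \<noteq> 0"
  shows "FV.independent (disc_fun n k X ` set Ss)"
proof -
  obtain J where J: "J \<in> ksubsets n (length Ss)"
    "det (submatrix (disc_submatrix n k X Ss) UNIV J) \<noteq> 0"
    using nz unfolding sum_sq_minors_def by (metis (no_types, lifting) sum.neutral zero_power2)
  have inj: "inj_on (disc_fun n k X) (set Ss)" using inj_on_subset[OF inj_on_disc_fun[OF U] Ss(2)] .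
  show ?thesis
  proof (rule FV.independent_if_scalars_zero)
    fix f x assume f: "(\<Sum>x\<in>disc_fun n k X ` set Ss. fscale (f x) x) = 0" and x: "x \<in> disc_fun n k X ` set Ss"
    have "(\<Sum>E\<in>set Ss. fscale (f (disc_fun n k X E)) (disc_fun n k X E)) = 0"
      using f inj by (simp add: sum.reindex)
    then have "(\<Sum>E\<in>set Ss. f (disc_fun n k X E) * disc_fun n k X E i) = 0" for i
      by (metis (mono_tags, lifting) sum.cong fscale_def sum_fun_apply zero_fun_def)
    then have "\<forall>E\<in>set Ss. f (disc_fun n k X E) = 0"
      using minor_nonzero_iff[OF Ss(1) J(1), of k X, THEN iffD1, OF J(2), THEN spec,
          of "\<lambda>E. f (disc_fun n k X E)"] by simp
    then show "f x = 0" using x by blast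
  qed simp
qed

section \<open>Independence of rows for generic configurations\<close>

text \<open>
  With coordinate subspaces \<open>F E\<close> and \<open>G K\<close>, all dimensions in \<open>generic_choice\<close>
  are cardinalities of unions, and its hypothesis becomes the Hall condition.
\<close>

lemma generic_supported_vectors:
  assumes \<B>: "\<B> \<subseteq> ksubsets n (k + 1)" "hall k \<B>"
  obtains u where "\<And>E. E \<in> \<B> \<Longrightarrow> u E \<in> supp_on E"
    "\<And>K. K \<in> ksubsets n k \<Longrightarrow> k + card \<B> \<le> FV.dim (unit_fun ` K \<union> u ` \<B>)"
proof -
  have "\<exists>u. (\<forall>E\<in>\<B>. u E \<in> FV.span (unit_fun ` E)) \<and>
      (\<forall>K\<in>ksubsets n k. k + card \<B> \<le> FV.dim (unit_fun ` K \<union> u ` \<B>))"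
  proof (rule FV.generic_choice)
    show "infinite (UNIV :: real set)" by (rule infinite_UNIV_char_0)
    show "finite \<B>" using finite_subset[OF \<B>(1) ksubsets_finite] .
    show "finite (ksubsets n k)" by (rule ksubsets_finite)
    show "finite (unit_fun ` E)" if "E \<in> \<B>" for E using that \<B>(1) ksubsetsD(3) by blast
    show "finite (unit_fun ` K)" if "K \<in> ksubsets n k" for K using that ksubsetsD(3) by blast
    fix K J assume K: "K \<in> ksubsets n k" and J: "J \<subseteq> \<B>"
    note K' = ksubsetsD[OF K]
    have fin: "finite (K \<union> \<Union>J)" using K' finite_Union_ksubsets[of J n "k + 1"] J \<B>(1) by auto
    have "k + card J \<le> card (K \<union> \<Union>J)"
    proof (cases "J = {}")
      case False
      then have "k + card J \<le> card (\<Union>J)" using hallD[OF \<B>(2) J] by blast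
      also have "\<dots> \<le> card (K \<union> \<Union>J)" using fin by (intro card_mono) auto
      finally show ?thesis .
    qed (use K' in simp)
    also have "\<dots> = FV.dim (unit_fun ` (K \<union> \<Union>J))" using dim_units[OF fin] by simp
    also have "unit_fun ` (K \<union> \<Union>J) = unit_fun ` K \<union> (\<Union>E\<in>J. unit_fun ` E)" by blast
    finally show "k + card J \<le> FV.dim (unit_fun ` K \<union> (\<Union>E\<in>J. unit_fun ` E))" .
  qed
  then obtain u where u: "\<forall>E\<in>\<B>. u E \<in> FV.span (unit_fun ` E)"
    "\<forall>K\<in>ksubsets n k. k + card \<B> \<le> FV.dim (unit_fun ` K \<union> u ` \<B>)" by blast
  have "u E \<in> supp_on E" if E: "E \<in> \<B>" for E
    using u(1) E span_units[of E] ksubsetsD(3)[of E n "k + 1"] \<B>(1) by auto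
  then show ?thesis using that u by blast
qed

text \<open>
  The span \<open>W\<close> of the chosen vectors has dimension \<open>n - k\<close> and is complementary to the
  coordinate subspace of every \<open>k\<close>-set. Row \<open>i\<close> of \<open>X\<close> is the projection of the
  \<open>i\<close>-th unit vector along \<open>W\<close> to the first \<open>k\<close> coordinates, so that
  \<open>W\<close> is the orthogonal complement of the columns of \<open>X\<close>. Complementarity makes
  \<open>X\<close> uniform, which forces the rows of \<open>Disc(X)\<close> to be multiples of the chosen vectors. It
  also says that a combination of them that vanishes on \<open>{k..<n}\<close> is trivial.
\<close>

lemma exists_matrix_with_nonzero_minor:
  assumes kn: "k < n" and \<B>: "\<B> \<subseteq> ksubsets n (k + 1)" "hall k \<B>" "card \<B> = n - k"
  obtains X where "X \<in> carrier_mat n k"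
    "\<And>c. (\<And>i. i \<in> {k..<n} \<Longrightarrow> (\<Sum>E\<in>\<B>. c E * disc_fun n k X E i) = 0) \<Longrightarrow> \<forall>E\<in>\<B>. c E = 0"
proof -
  obtain u where u: "\<And>E. E \<in> \<B> \<Longrightarrow> u E \<in> supp_on E"
    "\<And>K. K \<in> ksubsets n k \<Longrightarrow> k + card \<B> \<le> FV.dim (unit_fun ` K \<union> u ` \<B>)"
    using generic_supported_vectors[OF \<B>(1,2)] by blast
  have finB: "finite \<B>" using finite_subset[OF \<B>(1) ksubsets_finite] .
  let ?W = "FV.span (u ` \<B>)"
  \<comment> \<open>at most \<open>k + (n - k)\<close> vectors of which the span has dimension at least \<open>n\<close>\<close>
  have basis: "FV.independent (unit_fun ` K \<union> u ` \<B>)" "inj_on u \<B>" "unit_fun ` K \<inter> u ` \<B> = {}"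
    "card (unit_fun ` K \<union> u ` \<B>) = n" "finite (unit_fun ` K \<union> u ` \<B>)"
    if K: "K \<in> ksubsets n k" for K
  proof -
    note K' = ksubsetsD[OF K]
    have cK: "card (unit_fun ` K) = k" using K' by (simp add: card_image inj_unit)
    show fin: "finite (unit_fun ` K \<union> u ` \<B>)" using finB K' by simp
    have dim: "n \<le> FV.dim (unit_fun ` K \<union> u ` \<B>)" using u(2)[OF K] \<B>(3) kn by simp
    have "FV.dim (unit_fun ` K \<union> u ` \<B>) \<le> card (unit_fun ` K \<union> u ` \<B>)"
      using fin by (intro FV.dim_le_card FV.span_superset)
    then have ge: "n \<le> card (unit_fun ` K \<union> u ` \<B>)" using dim by simp
    have cuB: "card (u ` \<B>) \<le> n - k" using card_image_le[OF finB, of u] \<B>(3) by simp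
    have Un: "card (unit_fun ` K) + card (u ` \<B>) = card (unit_fun ` K \<union> u ` \<B>) + card (unit_fun ` K \<inter> u ` \<B>)"
      using fin by (intro card_Un_Int) auto
    show card: "card (unit_fun ` K \<union> u ` \<B>) = n" using Un ge cuB cK kn by linarith
    have "card (unit_fun ` K \<inter> u ` \<B>) = 0" using Un ge cuB cK kn by linarith
    then show "unit_fun ` K \<inter> u ` \<B> = {}" using fin by simp
    have "card (u ` \<B>) = card \<B>" using Un ge cuB cK kn \<B>(3) by linarith
    then show "inj_on u \<B>" using finB by (intro eq_card_imp_inj_on)
    show "FV.independent (unit_fun ` K \<union> u ` \<B>)"
      using fin dim card by (intro FV.independent_if_card_le_dim) simp_all
  qed
  have transversal: "f = 0" if "K \<in> ksubsets n k" "f \<in> supp_on K" "f \<in> ?W" for K f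
  proof -
    note K' = ksubsetsD[OF that(1)]
    show ?thesis
      using FV.span_Int_disjoint[OF basis(1)[OF that(1)] _ _ basis(3)[OF that(1)], of f]
        that(2,3) finB K' span_units[OF K'(3)] by simp
  qed
  let ?K = "{..<k}"
  have K: "?K \<in> ksubsets n k" using kn by (auto simp: ksubsets_def)
  let ?S = "unit_fun ` ?K \<union> u ` \<B>"
  have span: "supp_on {..<n} \<subseteq> FV.span ?S"
  proof
    fix h assume h: "h \<in> supp_on {..<n}"
    show "h \<in> FV.span ?S"
    proof (rule ccontr)
      assume nh: "h \<notin> FV.span ?S"
      have "supp_on E \<subseteq> supp_on {..<n}" if "E \<in> \<B>" for E
        using ksubsetsD(1)[of E n "k + 1"] \<B>(1) that by (auto simp: supp_on_def)
      then have "u ` \<B> \<subseteq> supp_on {..<n}" using u(1) by blast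
      moreover have "unit_fun ` ?K \<subseteq> supp_on {..<n}" using kn by (auto simp: supp_on_def unit_fun_def)
      ultimately have "insert h ?S \<subseteq> supp_on {..<n}" using h by simp
      then have "insert h ?S \<subseteq> FV.span (unit_fun ` {..<n})" by (simp add: span_units)
      moreover have "FV.independent (insert h ?S)"
        using nh basis(1)[OF K] by (rule FV.independent_insertI)
      ultimately have "card (insert h ?S) \<le> card (unit_fun ` {..<n})"
        using FV.independent_span_bound[of "unit_fun ` {..<n}" "insert h ?S"] by simp
      moreover have "h \<notin> ?S" using nh FV.span_base[of h ?S] by (rule contrapos_nn)
      ultimately show False using basis(4,5)[OF K] by (simp add: card_image inj_unit)
    qed
  qed
  \<comment> \<open>the projection along \<open>W\<close> to the first \<open>k\<close> coordinates\<close>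
  obtain g where g: "Vector_Spaces.linear fscale fscale g"
    "\<And>x. x \<in> ?S \<Longrightarrow> g x = (if x \<in> unit_fun ` ?K then x else 0)"
    using FVP.linear_independent_extend[OF basis(1)[OF K],
        of "\<lambda>x. if x \<in> unit_fun ` ?K then x else 0"] by blast
  interpret g: Vector_Spaces.linear fscale fscale g by (rule g(1))
  have gK: "g a = a" if "a \<in> supp_on ?K" for a
  proof -
    have "a = (\<Sum>i\<in>?K. fscale (a i) (unit_fun i))" using that by (rule supp_on_expand[rotated]) simp
    note a = this
    have "g a = g (\<Sum>i\<in>?K. fscale (a i) (unit_fun i))" using a by (rule arg_cong)
    also have "\<dots> = (\<Sum>i\<in>?K. fscale (a i) (g (unit_fun i)))" by (simp only: g.sum g.scale)
    also have "\<dots> = (\<Sum>i\<in>?K. fscale (a i) (unit_fun i))" using g(2) by (intro sum.cong) auto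
    finally show ?thesis using a by (rule trans[OF _ sym])
  qed
  have gW: "g w = 0" if "w \<in> ?W" for w
    using basis(3)[OF K] by (intro g.eq_0_on_span[OF _ that]) (auto simp: g(2))
  have gf: "f \<in> ?W \<longleftrightarrow> g f = 0" "g f \<in> supp_on ?K" if f: "f \<in> supp_on {..<n}" for f
  proof -
    obtain a w where aw: "f = a + w" "a \<in> supp_on ?K" "w \<in> ?W"
      using f span by (auto simp: FV.span_Un span_units)
    then have gfa: "g f = a" by (simp add: g.add gK gW)
    then show "g f \<in> supp_on ?K" using aw by simp
    show "f \<in> ?W \<longleftrightarrow> g f = 0" using gW gfa aw by auto
  qed
  define X where "X = mat n k (\<lambda>(i, j). g (unit_fun i) j)"
  have orth: "f \<in> col_orth n k X \<longleftrightarrow> f \<in> ?W" if f: "f \<in> supp_on {..<n}" for f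
  proof -
    have "f = (\<Sum>i<n. fscale (f i) (unit_fun i))" using f by (rule supp_on_expand[rotated]) simp
    then have "g f = g (\<Sum>i<n. fscale (f i) (unit_fun i))" by (rule arg_cong)
    also have "\<dots> = (\<Sum>i<n. fscale (f i) (g (unit_fun i)))" by (simp only: g.sum g.scale)
    finally have "g f = (\<Sum>i<n. fscale (f i) (g (unit_fun i)))" .
    then have "g f j = (\<Sum>i<n. f i * X $$ (i, j))" if "j < k" for j
      using that by (simp add: sum_fun_apply fscale_def X_def)
    then have "f \<in> col_orth n k X \<longleftrightarrow> (\<forall>j<k. g f j = 0)" by (simp add: col_orth_def)
    also have "\<dots> \<longleftrightarrow> g f = 0" using gf(2)[OF f] by (auto simp: supp_on_def fun_eq_iff)
    finally show ?thesis using gf(1)[OF f] by simp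
  qed
  have sub: "supp_on S \<subseteq> supp_on {..<n}" if "S \<in> ksubsets n m" for S m
    using ksubsetsD(1)[OF that] by (auto simp: supp_on_def)
  have U: "uniform_mat n k X"
    unfolding uniform_mat_def
  proof (intro ballI subsetI)
    fix K f assume Kf: "K \<in> ksubsets n k" "f \<in> supp_on K \<inter> col_orth n k X"
    then have "f \<in> ?W" using orth sub by blast
    then show "f \<in> {0}" using transversal Kf by blast
  qed
  have "\<exists>d. d \<noteq> 0 \<and> u E = fscale d (disc_fun n k X E)" if E: "E \<in> \<B>" for E
  proof -
    have EE: "E \<in> ksubsets n (k + 1)" using E \<B>(1) by blast
    moreover have "u E \<in> col_orth n k X"
      using orth[of "u E"] u(1)[OF E] sub[OF EE] FV.span_base[of "u E" "u ` \<B>"] E by blast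
    moreover have "u E \<noteq> 0" using FV.dependent_zero[of ?S] basis(1)[OF K] E by (metis UnI2 imageI)
    ultimately show ?thesis using proportional_disc_fun[OF U _ u(1)[OF E]] by metis
  qed
  then obtain d where d: "\<And>E. E \<in> \<B> \<Longrightarrow> d E \<noteq> 0"
    "\<And>E. E \<in> \<B> \<Longrightarrow> u E = fscale (d E) (disc_fun n k X E)" by metis
  show ?thesis
  proof (rule that)
    show "X \<in> carrier_mat n k" by (simp add: X_def)
    fix c assume c: "\<And>i. i \<in> {k..<n} \<Longrightarrow> (\<Sum>E\<in>\<B>. c E * disc_fun n k X E i) = 0"
    define f where "f = (\<Sum>E\<in>\<B>. fscale (c E / d E) (u E))"
    have "fscale (c E / d E) (u E) = fscale (c E) (disc_fun n k X E)" if "E \<in> \<B>" for E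
      using d(1)[OF that] by (simp add: d(2)[OF that])
    then have "f = (\<Sum>E\<in>\<B>. fscale (c E) (disc_fun n k X E))" by (simp add: f_def)
    then have fi: "f i = (\<Sum>E\<in>\<B>. c E * disc_fun n k X E i)" for i by (simp add: sum_fun_apply fscale_def)
    have "f i = 0" if "i \<notin> ?K" for i
    proof (cases "i < n")
      case True
      then show ?thesis using c that fi by simp
    next
      case False
      then show ?thesis by (simp add: fi disc_fun_def)
    qed
    then have "f \<in> supp_on ?K" by (simp add: supp_on_def)
    moreover have "f \<in> ?W" unfolding f_def by (intro FV.span_sum FV.span_scale FV.span_base) auto
    ultimately have f0: "f = 0" using transversal[OF K] by blast
    let ?c = "\<lambda>v. c (inv_into \<B> u v) / d (inv_into \<B> u v)"
    have "(\<Sum>v\<in>u ` \<B>. fscale (?c v) v) = f"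
      unfolding f_def using basis(2)[OF K] by (simp add: sum.reindex)
    then have "?c (u E) = 0" if "E \<in> \<B>" for E
      using FV.independentD[OF basis(1)[OF K], of "u ` \<B>" ?c "u E"] finB f0 that by simp
    then show "\<forall>E\<in>\<B>. c E = 0" using basis(2)[OF K] d(1) by simp
  qed
qed

text \<open>
  The ground set itself must be covered by one tight subcollection.
\<close>

lemma hall_basis_ksubsets_card:
  assumes kn: "k < n" and B: "hall_basis k (ksubsets n (k + 1)) \<B>"
  shows "card \<B> = n - k"
proof -
  note B' = hall_basis_finite[OF order_refl B]
  have "all_subsets_in n k (ksubsets n (k + 1)) {..<n}"
    using kn by (auto simp: all_subsets_in_def ksubsets_def)
  then obtain M where M: "M \<in> max_tight k \<B>" "{..<n} \<subseteq> \<Union>M"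
    using subsets_in_tight[OF order_refl B] by blast
  have MB: "M \<subseteq> \<B>" "card (\<Union>M) = k + card M" using M by (auto simp: max_tight_def tight_def)
  have "\<Union>M \<subseteq> {..<n}" "\<Union>\<B> \<subseteq> {..<n}"
    using Union_ksubsets_le[of _ n "k + 1"] MB(1) B'(2) by (meson order_trans)+
  then have 1: "\<Union>M = {..<n}" "\<Union>\<B> = {..<n}" using M(2) MB(1) by blast+
  then have "\<B> \<noteq> {}" using kn by auto
  then have "k + card \<B> \<le> n" using hallD[OF B'(3) order_refl] 1 by simp
  moreover have "card M \<le> card \<B>" using MB(1) B'(1) by (rule card_mono[rotated])
  ultimately show ?thesis using MB(2) 1 by simp
qed

lemma generic_uniform: "A \<in> generic_mats n k \<Longrightarrow> uniform_mat n k A"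
  by (rule uniform_mat_of_dets) (auto simp: generic_mats_def)

text \<open>
  For sufficiency the collection is first extended to \<open>n - k\<close> sets. For that size the constructed
  \<open>X\<close> has an explicit nonzero minor, and independence passes back to the subcollection.
\<close>

lemma generic_independent_iff_hall:
  assumes kn: "k < n" and A: "A \<in> generic_mats n k" and F: "\<F> \<subseteq> ksubsets n (k + 1)"
  shows "FV.independent (disc_fun n k A ` \<F>) \<longleftrightarrow> hall k \<F>"
proof
  show "FV.independent (disc_fun n k A ` \<F>) \<Longrightarrow> hall k \<F>"
    using independent_imp_hall[OF generic_uniform[OF A] F] .
  assume "hall k \<F>"
  then obtain \<B> where B: "hall_basis k (ksubsets n (k + 1)) \<B>" "\<F> \<subseteq> \<B>"
    using hall_basis_exists[OF order_refl F] by blast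
  note B' = hall_basis_finite[OF order_refl B(1)]
  note card = hall_basis_ksubsets_card[OF kn B(1)]
  obtain Ss where Ss: "set Ss = \<B>" "distinct Ss" using B'(1) finite_distinct_list by blast
  have len: "length Ss = n - k" using distinct_card[OF Ss(2)] Ss(1) card by simp
  obtain X where X: "X \<in> carrier_mat n k"
    "\<And>c. (\<And>i. i \<in> {k..<n} \<Longrightarrow> (\<Sum>E\<in>\<B>. c E * disc_fun n k X E i) = 0) \<Longrightarrow> \<forall>E\<in>\<B>. c E = 0"
    using exists_matrix_with_nonzero_minor[OF kn B'(2,3) card] by blast
  have J: "{k..<n} \<in> ksubsets n (length Ss)" using len by (auto simp: ksubsets_def)
  have "det (submatrix (disc_submatrix n k X Ss) UNIV {k..<n}) \<noteq> 0"
    using minor_nonzero_iff[OF Ss(2) J, of k X] X(2) unfolding Ss(1) by blast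
  then have "0 < (det (submatrix (disc_submatrix n k X Ss) UNIV {k..<n}))\<^sup>2" by simp
  also have "\<dots> \<le> sum_sq_minors n k Ss X"
    unfolding sum_sq_minors_def by (rule member_le_sum[OF J]) (simp_all add: ksubsets_finite)
  finally have "sum_sq_minors n k Ss X \<noteq> 0" by simp
  then have "sum_sq_minors n k Ss (indet_mat n k) \<noteq> 0"
    using sum_sq_minors_indet[OF X(1), of Ss] Ss(1) B'(2) by (auto simp: poly_val_0)
  then have "sum_sq_minors n k Ss A \<noteq> 0"
    using A Ss B'(2) by (auto simp: generic_mats_def)
  then have "FV.independent (disc_fun n k A ` \<B>)"
    using independent_of_sum_sq_minors[OF generic_uniform[OF A] Ss(2)] Ss(1) B'(2) by simp
  then show "FV.independent (disc_fun n k A ` \<F>)"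
    by (rule FV.independent_mono[OF _ image_mono[OF B(2)]])
qed

section \<open>Concurrency closure as linear closure\<close>

locale generic_config =
  fixes n k :: nat and A :: "real mat"
  assumes kn: "k < n" and A: "A \<in> generic_mats n k"
begin

abbreviation "rowA \<equiv> disc_fun n k A"

abbreviation "rspan \<D> \<equiv> FV.span (rowA ` \<D>)"

definition "flat \<D> = {E \<in> ksubsets n (k + 1). rowA E \<in> rspan \<D>}"

lemma uniform: "uniform_mat n k A"
  by (rule generic_uniform[OF A])

lemma independent_iff: "\<F> \<subseteq> ksubsets n (k + 1) \<Longrightarrow> FV.independent (rowA ` \<F>) \<longleftrightarrow> hall k \<F>"
  by (rule generic_independent_iff_hall[OF kn A])

lemma hall_insert_iff:
  assumes F: "\<F> \<subseteq> ksubsets n (k + 1)" "hall k \<F>" and E: "E \<in> ksubsets n (k + 1)" "E \<notin> \<F>"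
  shows "hall k (insert E \<F>) \<longleftrightarrow> rowA E \<notin> rspan \<F>"
proof -
  have "inj_on rowA (insert E \<F>)" using F(1) E(1) by (intro inj_on_subset[OF inj_on_disc_fun[OF uniform]]) auto
  then have "rowA E \<notin> rowA ` \<F>" using E(2) by (auto simp: inj_on_def)
  then have "FV.independent (rowA ` insert E \<F>) \<longleftrightarrow> rowA E \<notin> rspan \<F>"
    using independent_iff[OF F(1)] F(2) by (simp add: FV.independent_insert)
  then show ?thesis using independent_iff[of "insert E \<F>"] F(1) E(1) by simp
qed

lemma subset_flat: "\<D> \<subseteq> ksubsets n (k + 1) \<Longrightarrow> \<D> \<subseteq> flat \<D>"
  unfolding flat_def using FV.span_base[of _ "rowA ` \<D>"] by blast

lemma rspan_subset_iff: "rspan \<D> \<subseteq> rspan \<D>' \<longleftrightarrow> rowA ` \<D> \<subseteq> rspan \<D>'"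
  using FV.span_superset[of "rowA ` \<D>"] FV.span_minimal[OF _ FV.subspace_span, of "rowA ` \<D>" "rowA ` \<D>'"]
  by blast

lemma flat_eq_iff:
  assumes "\<D> \<subseteq> ksubsets n (k + 1)" "\<D>' \<subseteq> ksubsets n (k + 1)"
  shows "flat \<D> = flat \<D>' \<longleftrightarrow> rspan \<D> = rspan \<D>'"
proof
  assume eq: "flat \<D> = flat \<D>'"
  have "rowA ` \<D> \<subseteq> rspan \<D>'" "rowA ` \<D>' \<subseteq> rspan \<D>"
    using subset_flat[OF assms(1), unfolded eq] subset_flat[OF assms(2), folded eq]
    by (auto simp: flat_def)
  then show "rspan \<D> = rspan \<D>'" using rspan_subset_iff by blast
qed (simp add: flat_def)

lemma hall_basis_iff:
  assumes D: "\<D> \<subseteq> ksubsets n (k + 1)"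
  shows "hall_basis k \<D> \<B> \<longleftrightarrow> \<B> \<subseteq> \<D> \<and> hall k \<B> \<and> rspan \<B> = rspan \<D>"
proof -
  have "(\<forall>E\<in>\<D> - \<B>. \<not> hall k (insert E \<B>)) \<longleftrightarrow> rspan \<B> = rspan \<D>" if B: "\<B> \<subseteq> \<D>" "hall k \<B>"
  proof -
    have "(\<forall>E\<in>\<D> - \<B>. \<not> hall k (insert E \<B>)) \<longleftrightarrow> (\<forall>E\<in>\<D> - \<B>. rowA E \<in> rspan \<B>)"
    proof (rule ball_cong[OF refl])
      fix E assume E: "E \<in> \<D> - \<B>"
      then show "\<not> hall k (insert E \<B>) \<longleftrightarrow> rowA E \<in> rspan \<B>"
        using hall_insert_iff[OF order_trans[OF B(1) D] B(2), of E] D by auto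
    qed
    also have "\<dots> \<longleftrightarrow> rowA ` \<D> \<subseteq> rspan \<B>" using FV.span_base[of _ "rowA ` \<B>"] by blast
    also have "\<dots> \<longleftrightarrow> rspan \<D> \<subseteq> rspan \<B>" by (rule rspan_subset_iff[symmetric])
    also have "\<dots> \<longleftrightarrow> rspan \<B> = rspan \<D>" using FV.span_mono[OF image_mono[OF B(1)], of rowA] by blast
    finally show ?thesis .
  qed
  then show ?thesis unfolding hall_basis_def by blast
qed

text \<open>
  The two inequalities of the criterion say that \<open>\<F>\<close> is independent and that \<open>insert S
  \<F>\<close> is not.
\<close>

lemma criterion_imp_span:
  assumes D: "\<D> \<subseteq> ksubsets n (k + 1)" and S: "S \<in> ksubsets n (k + 1)" "conc_criterion k \<D> S"
  shows "rowA S \<in> rspan \<D>"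
proof -
  obtain \<F> where F: "\<F> \<subseteq> \<D>" "S \<notin> \<F>" "hall k \<F>" "card (\<Union>\<F> \<union> S) < k + card \<F> + 1"
    using S(2) unfolding conc_criterion_def hall_def by blast
  have F': "\<F> \<subseteq> ksubsets n (k + 1)" using F D by blast
  have "card (\<Union>(insert S \<F>)) < k + card (insert S \<F>)"
    using F finite_subset[OF F' ksubsets_finite] by (simp add: Un_commute)
  then have "\<not> hall k (insert S \<F>)" unfolding hall_def by (metis insert_not_empty leD order_refl)
  then have "rowA S \<in> rspan \<F>" using hall_insert_iff[OF F' F(3) S(1) F(2)] by blast
  then show ?thesis using FV.span_mono[OF image_mono[OF F(1)], of rowA] by blast
qed

text \<open>
  The witness is found inside a basis of \<open>\<D>\<close>, which cannot be extended by \<open>S\<close>.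
\<close>

lemma span_imp_criterion:
  assumes D: "\<D> \<subseteq> ksubsets n (k + 1)" and S: "S \<in> flat \<D>" "S \<notin> \<D>"
  shows "conc_criterion k \<D> S"
proof -
  have "hall k {}" by (simp add: hall_def)
  then obtain \<B> where B: "hall_basis k \<D> \<B>" using hall_basis_exists[OF D, of "{}"] by blast
  note B' = hall_basis_finite[OF D B]
  have BD: "\<B> \<subseteq> \<D>" "rspan \<B> = rspan \<D>" using B hall_basis_iff[OF D] by blast+
  have S': "S \<in> ksubsets n (k + 1)" "rowA S \<in> rspan \<B>" using S BD by (auto simp: flat_def)
  have "\<not> hall k (insert S \<B>)"
    using hall_insert_iff[OF B'(2,3) S'(1)] S' S(2) BD(1) by blast
  then obtain T where T: "T \<subseteq> \<B>" "T \<noteq> {}" "S \<notin> T" "card (\<Union>T \<union> S) < k + card T + 1"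
    using violated_insert[OF B'(1,3) _ ksubsetsD(2)[OF S'(1)]] by blast
  have "hall k T" using B'(3) T(1) by (rule hall_mono)
  then show ?thesis
    unfolding conc_criterion_def hall_def using T BD(1) by blast
qed

text \<open>
  The linear span absorbs every step of the iteration, and the first step already reaches it.
\<close>

lemma conc_closure_eq_flat:
  assumes D: "\<D> \<subseteq> ksubsets n (k + 1)"
  shows "conc_closure n k \<D> = flat \<D>"
proof
  have step: "conc_step n k \<E> \<subseteq> flat \<D>" if E: "\<E> \<subseteq> flat \<D>" for \<E>
  proof -
    have "\<E> \<subseteq> ksubsets n (k + 1)" "rowA ` \<E> \<subseteq> rspan \<D>" using E by (auto simp: flat_def)
    then have "rowA S \<in> rspan \<D>" if "S \<in> ksubsets n (k + 1)" "conc_criterion k \<E> S" for S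
      using criterion_imp_span[OF _ that] rspan_subset_iff by blast
    then show ?thesis using E by (auto simp: conc_step_def flat_def)
  qed
  have "(conc_step n k ^^ m) \<D> \<subseteq> flat \<D>" for m
    by (induction m) (simp_all add: subset_flat[OF D] step)
  then show "conc_closure n k \<D> \<subseteq> flat \<D>" unfolding conc_closure_def by blast
  have "flat \<D> \<subseteq> conc_step n k \<D>"
    using span_imp_criterion[OF D] by (auto simp: conc_step_def flat_def)
  also have "\<dots> = (conc_step n k ^^ 1) \<D>" by simp
  also have "\<dots> \<subseteq> conc_closure n k \<D>" unfolding conc_closure_def by blast
  finally show "flat \<D> \<subseteq> conc_closure n k \<D>" .
qed

lemma closed_flat:
  assumes "conc_closed n k \<D>"
  shows "flat \<D> = \<D>"
proof -
  have D: "\<D> \<subseteq> ksubsets n (k + 1)" using assms by (simp add: conc_closed_def)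
  have "S \<in> \<D>" if "S \<in> flat \<D>" for S
    using span_imp_criterion[OF D that] that assms by (auto simp: conc_closed_def flat_def)
  then show ?thesis using subset_flat[OF D] by blast
qed

text \<open>
  Minimality under inclusion is equivalent to independence because a maximal independent part of a collection has the
  same closure.
\<close>

lemma is_base_iff_hall_basis:
  assumes closed: "conc_closed n k \<D>"
  shows "is_base n k \<D> \<B> \<longleftrightarrow> hall_basis k \<D> \<B>"
proof
  have D: "\<D> \<subseteq> ksubsets n (k + 1)" using closed by (simp add: conc_closed_def)
  have clD: "conc_closure n k \<D> = \<D>" using conc_closure_eq_flat[OF D] closed_flat[OF closed] by simp
  {
    assume B: "is_base n k \<D> \<B>"
    then have B': "\<B> \<subseteq> ksubsets n (k + 1)" "conc_closure n k \<B> = conc_closure n k \<D>"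
      "\<And>\<B>'. \<B>' \<subseteq> \<B> \<Longrightarrow> conc_closure n k \<B>' = conc_closure n k \<D> \<Longrightarrow> \<B>' = \<B>"
      by (auto simp: is_base_def)
    have BD: "\<B> \<subseteq> \<D>" using subset_flat[OF B'(1)] B'(2) conc_closure_eq_flat[OF B'(1)] clD by simp
    have span: "rspan \<B> = rspan \<D>"
      using flat_eq_iff[OF B'(1) D] conc_closure_eq_flat B' D by simp
    have "hall k {}" by (simp add: hall_def)
    then obtain \<C> where C: "hall_basis k \<B> \<C>" using hall_basis_exists[OF B'(1), of "{}"] by blast
    then have C': "\<C> \<subseteq> \<B>" "hall k \<C>" "rspan \<C> = rspan \<B>" using hall_basis_iff[OF B'(1)] by blast+
    have "flat \<C> = flat \<D>" using C'(3) span by (simp add: flat_def)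
    then have "conc_closure n k \<C> = conc_closure n k \<D>"
      using conc_closure_eq_flat[OF order_trans[OF C'(1) B'(1)]] conc_closure_eq_flat[OF D] by simp
    then have "\<C> = \<B>" using B'(3)[OF C'(1)] by simp
    then show "hall_basis k \<D> \<B>" using hall_basis_iff[OF D] BD C'(2) span by blast
  }
  assume B: "hall_basis k \<D> \<B>"
  note B' = hall_basis_finite[OF D B]
  have BD: "\<B> \<subseteq> \<D>" "rspan \<B> = rspan \<D>" using B hall_basis_iff[OF D] by blast+
  show "is_base n k \<D> \<B>"
    unfolding is_base_def
  proof (intro conjI allI impI)
    show "\<B> \<subseteq> ksubsets n (k + 1)" using B' by blast
    show "conc_closure n k \<B> = conc_closure n k \<D>"
      using conc_closure_eq_flat[OF B'(2)] conc_closure_eq_flat[OF D] BD(2) by (simp add: flat_def)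
    fix \<C> assume C: "\<C> \<subseteq> \<B>" "conc_closure n k \<C> = conc_closure n k \<D>"
    have C': "\<C> \<subseteq> ksubsets n (k + 1)" using C B' by blast
    have "rspan \<C> = rspan \<B>"
      using C(2) conc_closure_eq_flat[OF C'] conc_closure_eq_flat[OF D] flat_eq_iff[OF C' D] BD(2) by simp
    moreover have "rspan \<C> \<noteq> rspan \<B>" if E: "E \<in> \<B>" "E \<notin> \<C>" for E
    proof -
      have "hall k (insert E \<C>)" using hall_mono[OF B'(3)] E C by blast
      then have "rowA E \<notin> rspan \<C>"
        using hall_insert_iff[OF C' hall_mono[OF B'(3) C(1)] _ E(2)] E(1) B'(2) by blast
      then show ?thesis using E(1) FV.span_base[of "rowA E" "rowA ` \<B>"] by blast
    qed
    ultimately show "\<C> = \<B>" using C(1) by blast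
  qed
qed

definition "members \<S> = {E \<in> ksubsets n (k + 1). \<exists>S\<in>\<S>. E \<subseteq> S}"

text \<open>
  For each member of \<open>\<T>\<close>, the star already spans all vectors that are supported there and orthogonal
  to the columns.
\<close>

lemma rspan_stars:
  assumes "kernels n k \<T> K"
  shows "rspan (kernels.stars \<T> K) = rspan (members \<T>)"
proof -
  interpret kernels n k \<T> K by fact
  have "E \<in> members \<T>" if "E \<in> stars" for E
  proof -
    obtain S where S: "S \<in> \<T>" "E \<in> star (K S) S" using \<open>E \<in> stars\<close> by (auto simp: stars_def)
    then have "E \<subseteq> S" using K(1)[OF S(1)] by (auto simp: star_def)
    then show ?thesis using S stars_ksubsets \<open>E \<in> stars\<close> by (auto simp: members_def)
  qed
  then have 1: "rspan stars \<subseteq> rspan (members \<T>)" by (intro FV.span_mono image_mono) blast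
  have "rowA E \<in> rspan stars" if E: "E \<in> members \<T>" for E
  proof -
    obtain S where S: "S \<in> \<T>" "E \<subseteq> S" and EE: "E \<in> ksubsets n (k + 1)"
      using E by (auto simp: members_def)
    have "rowA E \<in> supp_on S" using disc_fun_supp[OF EE] S(2) by (auto simp: supp_on_def)
    then have "rowA E \<in> rspan (star (K S) S)"
      using span_star[OF uniform PnkD(1)[OF T S(1)] K[OF S(1)]] disc_fun_col_orth[OF EE] by blast
    also have "\<dots> \<subseteq> rspan stars" using S by (intro FV.span_mono image_mono) (auto simp: stars_def)
    finally show ?thesis .
  qed
  then have "rowA ` members \<T> \<subseteq> rspan stars" by blast
  then have "rspan (members \<T>) \<subseteq> rspan stars" using rspan_subset_iff by blast
  then show ?thesis using 1 by (rule subset_antisym[rotated])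
qed

lemma hall_basis_stars:
  assumes "kernels n k \<T> K" and closed: "conc_closed n k \<D>" and span: "rspan (members \<T>) = rspan \<D>"
  shows "hall_basis k \<D> (kernels.stars \<T> K)"
proof -
  interpret kernels n k \<T> K by fact
  have D: "\<D> \<subseteq> ksubsets n (k + 1)" using closed by (simp add: conc_closed_def)
  have eq: "rspan stars = rspan \<D>" using rspan_stars[OF assms(1)] span by simp
  have "stars \<subseteq> flat stars" using stars_ksubsets by (rule subset_flat)
  also have "\<dots> = \<D>" using closed_flat[OF closed] by (simp add: flat_def eq)
  finally show ?thesis using hall_basis_iff[OF D] hall_stars eq by blast
qed

text \<open>
  The stars form a basis of \<open>\<D>\<close>, and from any basis the concurrency sets are read off as the unions of
  its maximal tight subcollections.
\<close>

lemma Pnk_unique: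
  assumes T: "\<T> \<in> Pnk n k" and closed: "conc_closed n k \<D>" and span: "rspan (members \<T>) = rspan \<D>"
  shows "\<T> = conc_sets n k \<D>"
proof -
  have "\<exists>K\<subseteq>S. card K = k" if "S \<in> \<T>" for S
    using obtain_subset_with_card_n[of k S] PnkD(2)[OF T that] by (metis add_leD1)
  then obtain K where K: "\<And>S. S \<in> \<T> \<Longrightarrow> K S \<subseteq> S \<and> card (K S) = k" by metis
  interpret kernels n k \<T> K by unfold_locales (use T K in auto)
  have "hall_basis k \<D> stars" using hall_basis_stars[OF kernels_axioms closed span] .
  then have "conc_sets n k \<D> = Union ` max_tight k stars"
    by (rule conc_sets_eq_Union_max_tight(1)[OF closed])
  then show ?thesis using Union_max_tight_stars by simp
qed

lemma members_conc_sets: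
  assumes closed: "conc_closed n k \<D>"
  shows "members (conc_sets n k \<D>) = \<D>"
    and "{E. card E = k + 1 \<and> (\<exists>S\<in>conc_sets n k \<D>. E \<subseteq> S)} = \<D>"
proof -
  have D: "\<D> \<subseteq> ksubsets n (k + 1)" using closed by (simp add: conc_closed_def)
  have "hall k {}" by (simp add: hall_def)
  then obtain \<B> where B: "hall_basis k \<D> \<B>" using hall_basis_exists[OF D, of "{}"] by blast
  have "\<exists>S\<in>conc_sets n k \<D>. E \<subseteq> S" if E: "E \<in> \<D>" for E
  proof -
    have "E \<in> ksubsets n (k + 1)" using E D by blast
    note E' = ksubsetsD[OF this]
    have "all_subsets_in n k \<D> E"
      unfolding all_subsets_in_def
    proof (intro conjI allI impI)
      fix E1 assume "E1 \<subseteq> E" "card E1 = k + 1"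
      then have "E1 = E" using E' by (intro card_subset_eq) auto
      then show "E1 \<in> \<D>" using E by simp
    qed (use E' in auto)
    then obtain M where "M \<in> max_tight k \<B>" "E \<subseteq> \<Union>M" using subsets_in_tight[OF D B] by blast
    then show ?thesis using conc_sets_eq_Union_max_tight(1)[OF closed B] by blast
  qed
  then show "members (conc_sets n k \<D>) = \<D>"
    "{E. card E = k + 1 \<and> (\<exists>S\<in>conc_sets n k \<D>. E \<subseteq> S)} = \<D>"
    using D by (auto simp: members_def ksubsets_def conc_sets_def all_subsets_in_def)
qed

lemma members_ksubsets: "\<D> \<subseteq> ksubsets n (k + 1) \<Longrightarrow> members \<D> = \<D>"
proof -
  assume D: "\<D> \<subseteq> ksubsets n (k + 1)"
  have "E = S" if "E \<in> ksubsets n (k + 1)" "S \<in> \<D>" "E \<subseteq> S" for E S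
    using that D ksubsetsD[of E n "k + 1"] ksubsetsD[of S n "k + 1"] by (intro card_subset_eq) auto
  then show ?thesis using D by (auto simp: members_def)
qed

end

definition vfun :: "nat \<Rightarrow> real vec \<Rightarrow> nat \<Rightarrow> real" where
  "vfun n v = (\<lambda>i. if i < n then v $ i else 0)"

lemma vfun_disc_row: "vfun n (disc_row n k X E) = disc_fun n k X E"
  by (simp add: vfun_def disc_fun_def)

lemma inj_on_vfun: "inj_on (vfun n) (carrier_vec n)"
  by (intro inj_onI eq_vecI) (auto simp: vfun_def fun_eq_iff, metis)

text \<open>
  This transfers spans from the module of vectors of dimension \<open>n\<close> to the space of functions.
\<close>

lemma module_span_iff:
  assumes S: "finite S" "S \<subseteq> carrier_vec n"
  shows "v \<in> LinearCombinations.module.span class_ring (module_vec TYPE(real) n) S \<longleftrightarrow>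
    v \<in> carrier_vec n \<and> vfun n v \<in> FV.span (vfun n ` S)"
proof -
  interpret vec_space "TYPE(real)" n .
  have inj: "inj_on (vfun n) S" using inj_on_subset[OF inj_on_vfun S(2)] .
  have "v \<in> span S \<longleftrightarrow> (\<exists>a. v = lincomb a S)"
    using finite_span[OF S] by auto
  also have "\<dots> \<longleftrightarrow> v \<in> carrier_vec n \<and> (\<exists>a. vfun n v = (\<Sum>x\<in>S. fscale (a x) (vfun n x)))"
  proof -
    have eq: "v = lincomb a S \<longleftrightarrow> v \<in> carrier_vec n \<and> vfun n v = (\<Sum>x\<in>S. fscale (a x) (vfun n x))" for a
    proof -
      have l: "lincomb a S \<in> carrier_vec n" using lincomb_dim[OF S] by (rule carrier_vecI)
      have "vfun n (lincomb a S) i = (\<Sum>x\<in>S. fscale (a x) (vfun n x)) i" for i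
        using lincomb_index[of i S a] S(2) by (simp add: vfun_def sum_fun_apply fscale_def)
      then have "vfun n (lincomb a S) = (\<Sum>x\<in>S. fscale (a x) (vfun n x))" by blast
      then show ?thesis using l inj_onD[OF inj_on_vfun] by metis
    qed
    then show ?thesis by blast
  qed
  also have "(\<exists>a. vfun n v = (\<Sum>x\<in>S. fscale (a x) (vfun n x))) \<longleftrightarrow>
      (\<exists>b. vfun n v = (\<Sum>y\<in>vfun n ` S. fscale (b y) y))"
  proof
    assume "\<exists>a. vfun n v = (\<Sum>x\<in>S. fscale (a x) (vfun n x))"
    then obtain a where a: "vfun n v = (\<Sum>x\<in>S. fscale (a x) (vfun n x))" by blast
    have "(\<Sum>y\<in>vfun n ` S. fscale (a (inv_into S (vfun n) y)) y) = vfun n v"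
      unfolding a using inj by (simp add: sum.reindex)
    then show "\<exists>b. vfun n v = (\<Sum>y\<in>vfun n ` S. fscale (b y) y)"
      by (intro exI[of _ "\<lambda>y. a (inv_into S (vfun n) y)"]) simp
  next
    assume "\<exists>b. vfun n v = (\<Sum>y\<in>vfun n ` S. fscale (b y) y)"
    then obtain b where "vfun n v = (\<Sum>y\<in>vfun n ` S. fscale (b y) y)" by blast
    then show "\<exists>a. vfun n v = (\<Sum>x\<in>S. fscale (a x) (vfun n x))"
      using inj by (intro exI[of _ "\<lambda>x. b (vfun n x)"]) (simp add: sum.reindex)
  qed
  also have "\<dots> \<longleftrightarrow> vfun n v \<in> FV.span (vfun n ` S)"
    using S(1) by (auto simp: FV.span_finite)
  finally show ?thesis .
qed

context generic_config
begin

lemma disc_row_carrier: "disc_row n k A E \<in> carrier_vec n"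
  by (simp add: disc_row_def)

lemma row_span_iff:
  "v \<in> row_span n k A \<S> \<longleftrightarrow> v \<in> carrier_vec n \<and> vfun n v \<in> rspan (members \<S>)"
proof -
  have eq: "{disc_row n k A E |E. E \<in> ksubsets n (k + 1) \<and> (\<exists>S\<in>\<S>. E \<subseteq> S)} = disc_row n k A ` members \<S>"
    by (auto simp: members_def)
  have "finite (members \<S>)" by (rule finite_subset[OF _ ksubsets_finite]) (auto simp: members_def)
  moreover have "vfun n ` disc_row n k A ` members \<S> = rowA ` members \<S>"
    by (simp add: image_image vfun_disc_row)
  ultimately show ?thesis
    unfolding row_span_def eq using module_span_iff[of "disc_row n k A ` members \<S>" n v] disc_row_carrier
    by (auto simp: image_subset_iff)
qed

lemma row_span_eq_iff: "row_span n k A \<S> = row_span n k A \<T> \<longleftrightarrow> rspan (members \<S>) = rspan (members \<T>)"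
proof
  have rowA: "rowA ` members \<S>' \<subseteq> rspan (members \<T>')" if "row_span n k A \<S>' = row_span n k A \<T>'" for \<S>' \<T>'
  proof (rule image_subsetI)
    fix E assume "E \<in> members \<S>'"
    then have "disc_row n k A E \<in> row_span n k A \<S>'"
      using disc_row_carrier FV.span_base[of "rowA E" "rowA ` members \<S>'"]
      by (simp add: row_span_iff vfun_disc_row)
    then have "disc_row n k A E \<in> row_span n k A \<T>'" by (simp only: that)
    then show "rowA E \<in> rspan (members \<T>')" by (simp add: row_span_iff vfun_disc_row)
  qed
  assume "row_span n k A \<S> = row_span n k A \<T>"
  then show "rspan (members \<S>) = rspan (members \<T>)"
    using rowA rspan_subset_iff by (intro subset_antisym) simp_all
next
  assume "rspan (members \<S>) = rspan (members \<T>)"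
  then have "v \<in> row_span n k A \<S> \<longleftrightarrow> v \<in> row_span n k A \<T>" for v by (simp add: row_span_iff)
  then show "row_span n k A \<S> = row_span n k A \<T>" by (intro subset_antisym subsetI) simp_all
qed

lemma vfun_finsum_vec:
  assumes "finite I" "\<And>E. E \<in> I \<Longrightarrow> w E \<in> carrier_vec n"
  shows "finsum_vec TYPE(real) n w I \<in> carrier_vec n"
    and "vfun n (finsum_vec TYPE(real) n w I) = (\<Sum>E\<in>I. vfun n (w E))"
proof -
  have w: "w \<in> I \<rightarrow> carrier_vec n" using assms by auto
  show "finsum_vec TYPE(real) n w I \<in> carrier_vec n" using finsum_vec_closed[OF w] .
  show "vfun n (finsum_vec TYPE(real) n w I) = (\<Sum>E\<in>I. vfun n (w E))"
    using index_finsum_vec[OF assms(1) _ w] by (auto simp: fun_eq_iff vfun_def sum_fun_apply)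
qed

lemma subspace_Sum_rows:
  assumes D: "\<D> \<subseteq> ksubsets n (k + 1)"
  shows "subspace_Sum n \<D> (\<lambda>E. row_span n k A {E}) = row_span n k A \<D>"
proof -
  have fin: "finite \<D>" using finite_subset[OF D ksubsets_finite] .
  have single: "members {E} = {E}" if "E \<in> \<D>" for E using members_ksubsets[of "{E}"] that D by auto
  note mem = members_ksubsets[OF D]
  show ?thesis
  proof (intro subset_antisym subsetI)
    fix v assume "v \<in> subspace_Sum n \<D> (\<lambda>E. row_span n k A {E})"
    then obtain w where v: "v = finsum_vec TYPE(real) n w \<D>" and w: "\<And>E. E \<in> \<D> \<Longrightarrow> w E \<in> row_span n k A {E}"
      by (auto simp: subspace_Sum_def)
    have "w E \<in> carrier_vec n" if "E \<in> \<D>" for E using w[OF that] by (simp add: row_span_iff)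
    note v' = vfun_finsum_vec[OF fin this]
    have "vfun n (w E) \<in> rspan \<D>" if E: "E \<in> \<D>" for E
    proof -
      have "vfun n (w E) \<in> rspan {E}" using w[OF E] single[OF E] by (simp add: row_span_iff)
      moreover have "rspan {E} \<subseteq> rspan \<D>" using E by (intro FV.span_mono image_mono) simp
      ultimately show ?thesis by blast
    qed
    then show "v \<in> row_span n k A \<D>"
      using v'(1) FV.span_sum[of \<D> "\<lambda>E. vfun n (w E)"] by (simp add: row_span_iff mem v v'(2))
  next
    fix v assume "v \<in> row_span n k A \<D>"
    then have v: "v \<in> carrier_vec n" "vfun n v \<in> rspan \<D>" by (simp_all add: row_span_iff mem)
    then obtain b where "vfun n v = (\<Sum>x\<in>rowA ` \<D>. fscale (b x) x)"
      using fin by (auto simp: FV.span_finite)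
    then have b: "vfun n v = (\<Sum>E\<in>\<D>. fscale (b (rowA E)) (rowA E))"
      using inj_on_subset[OF inj_on_disc_fun[OF uniform] D] by (simp add: sum.reindex)
    let ?w = "\<lambda>E. b (rowA E) \<cdot>\<^sub>v disc_row n k A E"
    have w: "?w E \<in> carrier_vec n" for E using disc_row_carrier by simp
    have wf: "vfun n (?w E) = fscale (b (rowA E)) (rowA E)" for E
      using disc_row_carrier[of E] by (auto simp: vfun_def fscale_def disc_fun_def)
    have "vfun n (finsum_vec TYPE(real) n ?w \<D>) = vfun n v"
      using vfun_finsum_vec(2)[OF fin w] by (simp add: wf b)
    then have "finsum_vec TYPE(real) n ?w \<D> = v"
      by (rule inj_onD[OF inj_on_vfun _ vfun_finsum_vec(1)[OF fin w] v(1)])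
    moreover have "?w E \<in> row_span n k A {E}" if E: "E \<in> \<D>" for E
      using w[of E] by (simp add: row_span_iff single[OF E] wf FV.span_scale FV.span_base)
    ultimately show "v \<in> subspace_Sum n \<D> (\<lambda>E. row_span n k A {E})"
      unfolding subspace_Sum_def by (intro CollectI exI[of _ ?w]) simp
  qed
qed

end

lemma pick_kernel:
  assumes "finite D" "k \<le> card D"
  shows "pick D ` {..<k} \<subseteq> D" "card (pick D ` {..<k}) = k"
    "star (pick D ` {..<k}) D = {insert (pick D l) (pick D ` {..<k}) |l. k \<le> l \<and> l < card D}"
proof -
  have bij: "inj_on (pick D) {..<card D}" "pick D ` {..<card D} = D"
    using bij_betw_pick[OF assms(1)] by (auto simp: bij_betw_def)
  have sub: "{..<k} \<subseteq> {..<card D}" using assms(2) by auto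
  show "pick D ` {..<k} \<subseteq> D" using image_mono[OF sub, of "pick D"] bij(2) by simp
  show "card (pick D ` {..<k}) = k" using inj_on_subset[OF bij(1) sub] by (simp add: card_image)
  have "D - pick D ` {..<k} = pick D ` ({..<card D} - {..<k})"
    using inj_on_image_set_diff[OF bij(1) Diff_subset sub] bij(2) by simp
  then show "star (pick D ` {..<k}) D = {insert (pick D l) (pick D ` {..<k}) |l. k \<le> l \<and> l < card D}"
    by (auto simp: star_def image_image)
qed

theorem theorem7p24:
  fixes n k :: nat and A :: "real mat" and \<D> \<S> :: "nat set set"
  assumes "0 < k" and "k < n"
    and "A \<in> generic_mats n k"
    and "conc_closed n k \<D>"
    and "\<S> = conc_sets n k \<D>"
  shows
    "(\<S> \<in> Pnk n k \<and>
      row_span n k A \<S> =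
        subspace_Sum n {E. card E = k + 1 \<and> (\<exists>D\<in>\<S>. E \<subseteq> D)} (\<lambda>E. row_span n k A {E}) \<and>
      subspace_Sum n {E. card E = k + 1 \<and> (\<exists>D\<in>\<S>. E \<subseteq> D)} (\<lambda>E. row_span n k A {E}) =
        subspace_Sum n \<D> (\<lambda>E. row_span n k A {E}) \<and>
      subspace_Sum n \<D> (\<lambda>E. row_span n k A {E}) = row_span n k A \<D> \<and>
      (\<forall>\<T>\<in>Pnk n k. row_span n k A \<T> = row_span n k A \<D> \<longrightarrow> \<T> = \<S>)) \<and>
     is_base n k \<D>
       {insert (pick D l) (pick D ` {..<k}) | D l. D \<in> \<S> \<and> k \<le> l \<and> l < card D} \<and>
     (\<forall>\<B>. is_base n k \<D> \<B> \<longrightarrow> card \<B> = (\<Sum>D\<in>\<S>. nu k D))"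
proof -
  interpret generic_config n k A by unfold_locales (use assms in auto)
  note closed = assms(4)
  have D: "\<D> \<subseteq> ksubsets n (k + 1)" using closed by (simp add: conc_closed_def)
  have S: "\<S> \<in> Pnk n k" using conc_sets_in_Pnk[OF closed] assms(5) by simp
  have mem: "members \<S> = \<D>" "{E. card E = k + 1 \<and> (\<exists>D\<in>\<S>. E \<subseteq> D)} = \<D>"
    using members_conc_sets[OF closed] assms(5) by simp_all
  note sum = subspace_Sum_rows[OF D]
  have row_span: "row_span n k A \<S> = row_span n k A \<D>"
    by (simp add: row_span_eq_iff mem(1) members_ksubsets[OF D])
  have unique: "\<T> = \<S>" if "\<T> \<in> Pnk n k" "row_span n k A \<T> = row_span n k A \<D>" for \<T>
    using Pnk_unique[OF that(1) closed] that(2) assms(5)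
    by (simp add: row_span_eq_iff members_ksubsets[OF D])
  interpret kernels n k \<S> "\<lambda>S. pick S ` {..<k}"
  proof
    fix S' assume "S' \<in> \<S>"
    then have "finite S'" "k \<le> card S'" using PnkD[OF S] by fastforce+
    then show "pick S' ` {..<k} \<subseteq> S'" "card (pick S' ` {..<k}) = k" using pick_kernel by blast+
  qed (rule S)
  have "stars = {insert (pick D l) (pick D ` {..<k}) |D l. D \<in> \<S> \<and> k \<le> l \<and> l < card D}"
  proof -
    have "star (pick D ` {..<k}) D = {insert (pick D l) (pick D ` {..<k}) |l. k \<le> l \<and> l < card D}"
      if "D \<in> \<S>" for D
      using pick_kernel(3)[OF PnkD(3)[OF S that]] PnkD(2)[OF S that] by simp
    then show ?thesis unfolding stars_def by auto
  qed
  moreover have "hall_basis k \<D> stars" using hall_basis_stars[OF kernels_axioms closed] mem(1) by simp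
  ultimately have base: "is_base n k \<D>
      {insert (pick D l) (pick D ` {..<k}) |D l. D \<in> \<S> \<and> k \<le> l \<and> l < card D}"
    using is_base_iff_hall_basis[OF closed] by simp
  have card: "card \<B> = (\<Sum>D\<in>\<S>. nu k D)" if "is_base n k \<D> \<B>" for \<B>
    using card_hall_basis[OF closed] is_base_iff_hall_basis[OF closed] that assms(5) by simp
  show ?thesis
    unfolding mem(2) sum row_span
    by (intro conjI ballI allI impI S refl base) (fact unique, fact card)
qed

end
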